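(* Fix $k\in \mathbb{N}_{\geq 1}\cup \{\infty\}$. Let $\Phi$ be a $C^k$ flow on a connected compact $n$-dimensional $C^k$ manifold $X$. Assume there is a $C^k$ map $F\colon X \to T^n$ to the $n$-torus $T^n = \mathbb{R}^n/\mathbb{Z}^n$ and a vector $\boldsymbol \omega\in \mathbb{R}^n$ with rationally independent components such that $F(\Phi^t(x)) = \boldsymbol \omega t + F(x) \bmod 1$ for all $x\in X$, $t\in \mathbb{R}$. Then there is a $C^k$ diffeomorphism $\psi\colon X\to T^n$ with respect to which $F$ is induced by an invertible matrix with integer entries (that is, there is an $n\times n$ integer matrix $M$, invertible as a real matrix, such that $F\circ\psi^{-1}(y)=My \bmod 1$ for all $y\in T^n$) and $\Phi$ is the flow of a constant vector field $\tilde{\boldsymbol \omega}\in \mathbb{R}^n$ on $T^n$ with rationally independent components (that is, $\psi\circ\Phi^t\circ\psi^{-1}(y)=\tilde{\boldsymbol\omega}t+y \bmod 1$ for all $y\in T^n$, $t\in\mathbb{R}$). In particular, $(X,\Phi)$ is linearizable by a $C^k$ embedding.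
   Context: Manifolds are, as usual, finite-dimensional, Hausdorff, second countable and without boundary. A flow on $X$ is a group action $\Phi\colon \mathbb{R}\times X\to X$, $(t,x)\mapsto \Phi^t(x)$, of $(\mathbb{R},+)$ on $X$; it is $C^k$ if $\Phi$ is a $C^k$ map. "$\bmod\ 1$" is applied entrywise. Real numbers $\omega_1,\dots,\omega_n$ are rationally independent if they are linearly independent over $\mathbb{Q}$. A map $E\colon X\to\mathbb{R}^m$ is linearizing (for $\Phi$) if there is a matrix $B\in\mathbb{R}^{m\times m}$ such that $E\circ\Phi^t=e^{Bt}\circ E$ for all $t\in\mathbb{R}$. A $C^k$ embedding ($k\ge 1$) is a $C^k$ map that is both an immersion and a homeomorphism onto its image. $(X,\Phi)$ is linearizable by a $C^k$ embedding if for some $m\in\mathbb{N}$ there is a linearizing $C^k$ embedding $X\to\mathbb{R}^m$. *)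

theory Defs
  imports "HOL-Analysis.Analysis" "HOL-Library.Extended_Nat"
begin

text \<open>
  On an open set of a finite-dimensional space, \<open>f\<close> is \<open>C\<^sup>m\<^sup>+\<^sup>1\<close> iff it is
  (Frechet) differentiable and every directional derivative \<open>x \<mapsto> Df(x) v\<close> is \<open>C\<^sup>m\<close>.
\<close>

primrec cont_diff_on :: "nat \<Rightarrow> 'e::euclidean_space set \<Rightarrow> ('e \<Rightarrow> 'f::euclidean_space) \<Rightarrow> bool" where
  "cont_diff_on 0 S f \<longleftrightarrow> continuous_on S f"
| "cont_diff_on (Suc m) S f \<longleftrightarrow>
     (\<forall>x\<in>S. f differentiable (at x)) \<and>
     (\<forall>v. cont_diff_on m S (\<lambda>x. frechet_derivative f (at x) v))"

definition Ck_on :: "enat \<Rightarrow> 'e::euclidean_space set \<Rightarrow> ('e \<Rightarrow> 'f::euclidean_space) \<Rightarrow> bool" where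
  "Ck_on k S f \<longleftrightarrow> (\<forall>m. enat m \<le> k \<longrightarrow> cont_diff_on m S f)"

lemma cont_diff_on_const: "cont_diff_on m S (\<lambda>x. c)"
  by (induction m arbitrary: c) (auto simp: frechet_derivative_const)

lemma cont_diff_on_cong:
  assumes "open S" "\<And>x. x \<in> S \<Longrightarrow> f x = g x" "cont_diff_on m S f"
  shows "cont_diff_on m S g"
  using assms(2,3)
proof (induction m arbitrary: f g)
  case 0
  then show ?case by (auto cong: continuous_on_cong)
next
  case (Suc m)
  have der: "(f has_derivative D) (at x) \<longleftrightarrow> (g has_derivative D) (at x)" if "x \<in> S" for D x
    using has_derivative_transform_within_open[OF _ assms(1) that] Suc.prems(1) by metis
  have "frechet_derivative f (at x) v = frechet_derivative g (at x) v" if "x \<in> S" for x v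
    using der[OF that] by (simp add: frechet_derivative_def)
  then have "cont_diff_on m S (\<lambda>x. frechet_derivative g (at x) v)" for v
    using Suc.IH[of "\<lambda>x. frechet_derivative f (at x) v" "\<lambda>x. frechet_derivative g (at x) v"]
      Suc.prems(2) by simp
  moreover have "g differentiable (at x)" if "x \<in> S" for x
    using Suc.prems(2) that unfolding differentiable_def cont_diff_on.simps
    by (metis der)
  ultimately show ?case
    by simp
qed

text \<open>
  A manifold is a type \<open>'a\<close> with its topology, together with an atlas of charts \<open>(U, \<phi>)\<close>
  with values in the model space \<open>'e\<close>. Since \<open>\<phi>\<close> is a total function, its values outside
  \<open>U\<close> are irrelevant, and its inverse is \<open>the_inv_into U \<phi>\<close>.
  The Hausdorff property and second countability are the sort
  \<open>{t2_space, second_countable_topology}\<close> of \<open>'a\<close>.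
\<close>

type_synonym ('a, 'e) chart = "'a set \<times> ('a \<Rightarrow> 'e)"

definition is_chart :: "('a::topological_space, 'e::euclidean_space) chart \<Rightarrow> bool" where
  "is_chart = (\<lambda>(U, \<phi>). open U \<and> open (\<phi> ` U) \<and> homeomorphism U (\<phi> ` U) \<phi> (the_inv_into U \<phi>))"

definition Ck_atlas :: "enat \<Rightarrow> ('a::topological_space, 'e::euclidean_space) chart set \<Rightarrow> bool" where
  "Ck_atlas k A \<longleftrightarrow>
     (\<forall>c\<in>A. is_chart c) \<and>
     (\<Union>(U, \<phi>)\<in>A. U) = UNIV \<and>
     (\<forall>(U, \<phi>)\<in>A. \<forall>(V, \<psi>)\<in>A. Ck_on k (\<phi> ` (U \<inter> V)) (\<psi> \<circ> the_inv_into U \<phi>))"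

definition Ck_manifold ::
    "enat \<Rightarrow> ('a::{t2_space, second_countable_topology}, 'e::euclidean_space) chart set \<Rightarrow> bool" where
  "Ck_manifold k A \<longleftrightarrow> Ck_atlas k A"

definition Ck_map ::
    "enat \<Rightarrow> ('a::topological_space, 'e::euclidean_space) chart set \<Rightarrow>
     ('b::topological_space, 'f::euclidean_space) chart set \<Rightarrow> ('a \<Rightarrow> 'b) \<Rightarrow> bool" where
  "Ck_map k A B f \<longleftrightarrow>
     continuous_on UNIV f \<and>
     (\<forall>(U, \<phi>)\<in>A. \<forall>(V, \<psi>)\<in>B. Ck_on k (\<phi> ` (U \<inter> f -` V)) (\<psi> \<circ> f \<circ> the_inv_into U \<phi>))"

definition Ck_diffeomorphism ::
    "enat \<Rightarrow> ('a::topological_space, 'e::euclidean_space) chart set \<Rightarrow>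
     ('b::topological_space, 'f::euclidean_space) chart set \<Rightarrow> ('a \<Rightarrow> 'b) \<Rightarrow> bool" where
  "Ck_diffeomorphism k A B f \<longleftrightarrow> bij f \<and> Ck_map k A B f \<and> Ck_map k B A (inv f)"

definition std_atlas :: "('e::euclidean_space, 'e) chart set" where
  "std_atlas = {(UNIV, id)}"

definition prod_atlas ::
    "('a, 'e) chart set \<Rightarrow> ('b, 'f) chart set \<Rightarrow> ('a \<times> 'b, 'e \<times> 'f) chart set" where
  "prod_atlas A B = (\<lambda>((U, \<phi>), (V, \<psi>)). (U \<times> V, map_prod \<phi> \<psi>)) ` (A \<times> B)"

definition torus_rel :: "real^'n::finite \<Rightarrow> real^'n \<Rightarrow> bool" where
  "torus_rel x y \<longleftrightarrow> (\<forall>i. x $ i - y $ i \<in> \<int>)"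

lemma equivp_torus_rel: "equivp (torus_rel :: real^'n::finite \<Rightarrow> real^'n \<Rightarrow> bool)" (is "equivp ?R")
proof (rule equivpI)
  show "reflp ?R"
    by (simp add: reflp_def torus_rel_def)
  show "symp ?R"
  proof (rule sympI)
    fix x y :: "real^'n"
    assume a: "torus_rel x y"
    have "- (x $ i - y $ i) \<in> \<int>" for i
      by (rule Ints_minus) (use a in \<open>simp add: torus_rel_def\<close>)
    then show "torus_rel y x"
      by (simp add: torus_rel_def)
  qed
  show "transp ?R"
  proof (rule transpI)
    fix x y z :: "real^'n"
    assume a: "torus_rel x y" "torus_rel y z"
    have "(x $ i - y $ i) + (y $ i - z $ i) \<in> \<int>" for i
      by (rule Ints_add) (use a in \<open>auto simp: torus_rel_def\<close>)
    then show "torus_rel x z"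
      by (simp add: torus_rel_def)
  qed
qed

quotient_type (overloaded) 'n torus = "real^'n::finite" / torus_rel
  morphisms torus_rep mod1
  by (rule equivp_torus_rel)

instantiation torus :: (finite) topological_space
begin

definition open_torus :: "'a torus set \<Rightarrow> bool" where
  "open_torus U \<longleftrightarrow> open (mod1 -` U)"

instance
proof
  show "open (UNIV :: 'a torus set)"
    by (simp add: open_torus_def)
  show "open (S \<inter> T)" if "open S" "open T" for S T :: "'a torus set"
    using that by (auto simp: open_torus_def intro: open_Int)
  show "open (\<Union>K)" if "\<forall>S\<in>K. open S" for K :: "'a torus set set"
    using that by (auto simp: open_torus_def vimage_Union)
qed

end

instantiation torus :: (finite) plus
begin

lift_definition plus_torus :: "'a torus \<Rightarrow> 'a torus \<Rightarrow> 'a torus" is "(+)"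
proof -
  fix x x' y y' :: "real^'a"
  assume a: "torus_rel x x'" "torus_rel y y'"
  show "torus_rel (x + y) (x' + y')"
    unfolding torus_rel_def
  proof
    fix i
    have "(x + y) $ i - (x' + y') $ i = (x $ i - x' $ i) + (y $ i - y' $ i)"
      by simp
    also have "\<dots> \<in> \<int>"
      by (rule Ints_add) (use a in \<open>auto simp: torus_rel_def\<close>)
    finally show "(x + y) $ i - (x' + y') $ i \<in> \<int>" .
  qed
qed

instance ..

end

lemma mod1_eq_iff: "mod1 x = mod1 y \<longleftrightarrow> (\<forall>i. x $ i - y $ i \<in> \<int>)"
  by (simp add: torus.abs_eq_iff torus_rel_def)

lemma surj_mod1: "\<exists>x. mod1 x = y"
  by (metis Quotient_torus Quotient_abs_rep)

lemma continuous_on_mod1: "continuous_on S mod1"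
  by (rule continuous_on_subset[of UNIV]) (auto simp: continuous_on_open_vimage open_torus_def)

lemma open_mod1_image:
  assumes "open V"
  shows "open (mod1 ` V)"
proof -
  have "mod1 -` mod1 ` V = (\<Union>z\<in>{z. \<forall>i. z $ i \<in> \<int>}. (+) z ` V)" (is "?L = ?R")
  proof
    show "?L \<subseteq> ?R"
    proof
      fix x assume "x \<in> ?L"
      then obtain y where y: "y \<in> V" "mod1 x = mod1 y" by auto
      then have "x - y \<in> {z. \<forall>i. z $ i \<in> \<int>}" by (simp add: mod1_eq_iff)
      moreover have "x \<in> (+) (x - y) ` V" using y(1) by (intro image_eqI[of _ _ y]) auto
      ultimately show "x \<in> ?R" by blast
    qed
    show "?R \<subseteq> ?L"
    proof
      fix x assume "x \<in> ?R"
      then obtain z y where "\<forall>i. z $ i \<in> \<int>" "y \<in> V" "x = z + y" by auto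
      then have "mod1 x = mod1 y" by (simp add: mod1_eq_iff)
      then show "x \<in> ?L" using \<open>y \<in> V\<close> by auto
    qed
  qed
  then show ?thesis
    using assms by (auto simp: open_torus_def intro!: open_UN open_translation)
qed

lemma norm_int_vec_ge_1:
  assumes "\<forall>i. z $ i \<in> \<int>" "z \<noteq> 0"
  shows "1 \<le> norm (z :: real^'n::finite)"
proof -
  obtain i where "z $ i \<noteq> 0" using assms(2) by (auto simp: vec_eq_iff)
  then have "1 \<le> \<bar>z $ i\<bar>" using assms(1) by (auto intro: Ints_nonzero_abs_ge1)
  also have "\<dots> \<le> norm z" by (rule component_le_norm_cart)
  finally show ?thesis .
qed

lemma inj_on_mod1_ball: "inj_on mod1 (ball x (1/2))"
proof (rule inj_onI)
  fix y z assume yz: "y \<in> ball x (1/2)" "z \<in> ball x (1/2)" "mod1 y = mod1 z"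
  have "dist y z < 1"
    using yz(1,2) dist_triangle_half_r[of x y 1 z] by (auto simp: dist_commute)
  then have "norm (y - z) < 1" by (simp add: dist_norm)
  then have "y - z = 0"
    using norm_int_vec_ge_1[of "y - z"] yz(3) by (auto simp: mod1_eq_iff)
  then show "y = z" by simp
qed

instance torus :: (finite) t2_space
proof
  fix a b :: "'a torus"
  assume ab: "a \<noteq> b"
  obtain x y where xy: "a = mod1 x" "b = mod1 y" by (metis surj_mod1)
  define L where "L = {z :: real^'a. \<forall>i. z $ i \<in> \<int>}"
  have "closed L"
  proof -
    have "L = (\<Inter>i. (\<lambda>z. z $ i) -` \<int>)" by (auto simp: L_def)
    then show ?thesis
      by (simp add: closed_INT closed_vimage continuous_on_component continuous_on_id)
  qed
  moreover have "y - x \<notin> L" using ab by (auto simp: xy L_def mod1_eq_iff) (metis Ints_minus minus_diff_eq)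
  ultimately obtain e where e: "e > 0" "ball (y - x) e \<inter> L = {}"
    by (metis ComplI Compl_disjoint open_Compl openE disjoint_eq_subset_Compl)
  have "mod1 ` ball x (e/2) \<inter> mod1 ` ball y (e/2) = {}"
  proof (rule ccontr)
    assume "\<not> ?thesis"
    then obtain u v where uv: "dist x u < e/2" "dist y v < e/2" "mod1 v = mod1 u" by fastforce
    then have "v - u \<in> L" by (simp add: mod1_eq_iff L_def)
    moreover have "dist (y - x) (v - u) < e"
    proof -
      have "norm ((y - v) + (u - x)) \<le> norm (y - v) + norm (u - x)" by (rule norm_triangle_ineq)
      also have "\<dots> < e" using uv(1,2) by (simp add: dist_norm norm_minus_commute)
      finally show ?thesis by (simp add: dist_norm algebra_simps)
    qed
    ultimately show False using e(2) by auto
  qed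
  then show "\<exists>U V. open U \<and> open V \<and> a \<in> U \<and> b \<in> V \<and> U \<inter> V = {}"
    using e(1) by (intro exI[of _ "mod1 ` ball x (e/2)"] exI[of _ "mod1 ` ball y (e/2)"])
      (auto simp: xy intro!: open_mod1_image)
qed

instance torus :: (finite) second_countable_topology
proof
  obtain B :: "(real^'a) set set" where B: "countable B" "topological_basis B"
    using ex_countable_basis by auto
  have "topological_basis ((`) mod1 ` B)"
  proof (rule topological_basisI)
    show "open S" if "S \<in> (`) mod1 ` B" for S :: "'a torus set"
      using that B(2) open_mod1_image topological_basis_open by auto
    fix S :: "'a torus set" and a
    assume S: "open S" "a \<in> S"
    obtain x where x: "a = mod1 x" by (metis surj_mod1)
    obtain V where "V \<in> B" "x \<in> V" "V \<subseteq> mod1 -` S"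
      using topological_basisE[OF B(2), of "mod1 -` S" x] S x by (auto simp: open_torus_def)
    then show "\<exists>B'\<in>(`) mod1 ` B. a \<in> B' \<and> B' \<subseteq> S"
      by (intro bexI[of _ "mod1 ` V"]) (auto simp: x)
  qed
  then show "\<exists>B :: 'a torus set set. countable B \<and> open = generate_topology B"
    using B(1) topological_basis_imp_subbasis by blast
qed

text \<open>The charts of the torus are the local inverses of the projection \<open>mod1\<close>.\<close>

definition torus_atlas :: "('n::finite torus, real^'n) chart set" where
  "torus_atlas = {(mod1 ` V, the_inv_into V mod1) | V. open V \<and> inj_on mod1 V}"

lemma torus_chart:
  assumes "open V" "inj_on mod1 V"
  shows "is_chart (mod1 ` V, the_inv_into V mod1)"
    and "\<And>x. x \<in> V \<Longrightarrow> the_inv_into (mod1 ` V) (the_inv_into V mod1) x = mod1 x"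
    and "continuous_on (mod1 ` V) (the_inv_into V mod1)"
proof -
  let ?g = "the_inv_into V mod1"
  have img: "?g ` mod1 ` V = V"
    using the_inv_into_onto[OF assms(2)] by simp
  have g: "?g (mod1 x) = x" if "x \<in> V" for x
    using the_inv_into_f_f[OF assms(2) that] .
  show inv: "the_inv_into (mod1 ` V) ?g x = mod1 x" if "x \<in> V" for x
    using that assms(2) by (intro the_inv_into_f_eq) (auto simp: g inj_on_def)
  have op: "openin (top_of_set (mod1 ` V)) (mod1 ` T)" if "openin (top_of_set V) T" for T
  proof -
    from that assms(1) have "open T" "T \<subseteq> V" by (auto simp: openin_open_eq)
    then show ?thesis
      using open_mod1_image[of T] by (auto simp: openin_open_eq open_mod1_image assms(1))
  qed
  show cont: "continuous_on (mod1 ` V) ?g"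
    by (rule continuous_on_inverse_open_map[OF continuous_on_mod1 refl]) (auto simp: g op)
  have "continuous_on V (the_inv_into (mod1 ` V) ?g)"
    by (rule continuous_on_eq[OF continuous_on_mod1]) (rule inv[symmetric])
  then show "is_chart (mod1 ` V, ?g)"
    using assms(1) open_mod1_image cont
    by (auto simp: is_chart_def homeomorphism_def image_image g inv cong: image_cong)
qed

lemma Ck_atlas_torus: "Ck_atlas k torus_atlas"
proof -
  have cov: "\<exists>c\<in>torus_atlas. a \<in> fst c" for a :: "'a torus"
  proof -
    obtain x where "a = mod1 x" by (metis surj_mod1)
    then show ?thesis
      unfolding torus_atlas_def using inj_on_mod1_ball[of x]
      by (intro bexI[of _ "(mod1 ` ball x (1/2), the_inv_into (ball x (1/2)) mod1)"]) auto
  qed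
  have trans: "Ck_on k (the_inv_into V mod1 ` (mod1 ` V \<inter> mod1 ` W))
      (the_inv_into W mod1 \<circ> the_inv_into (mod1 ` V) (the_inv_into V mod1))"
    if V: "open V" "inj_on mod1 V" and W: "open W" "inj_on mod1 W" for V W :: "(real^'a) set"
  proof -
    let ?S = "V \<inter> mod1 -` mod1 ` W"
    let ?f = "the_inv_into W mod1 \<circ> mod1"
    have img: "the_inv_into V mod1 ` (mod1 ` V \<inter> mod1 ` W) = ?S"
    proof -
      have "mod1 ` V \<inter> mod1 ` W = mod1 ` ?S" by auto
      then have "the_inv_into V mod1 ` (mod1 ` V \<inter> mod1 ` W) = (\<lambda>x. the_inv_into V mod1 (mod1 x)) ` ?S"
        by (simp only: image_image)
      also have "\<dots> = (\<lambda>x. x) ` ?S"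
        by (rule image_cong) (use the_inv_into_f_f[OF V(2)] in auto)
      finally show ?thesis by simp
    qed
    have oS: "open ?S"
      using V(1) open_mod1_image[OF W(1)] by (auto simp: open_torus_def)
    have int: "?f x - x \<in> {z. \<forall>i. z $ i \<in> \<int>}" if "x \<in> ?S" for x
    proof -
      have "mod1 (?f x) = mod1 x" using that f_the_inv_into_f[OF W(2)] by auto
      then show ?thesis by (simp add: mod1_eq_iff)
    qed
    have contf: "continuous_on ?S ?f"
      by (intro continuous_on_compose continuous_on_mod1 continuous_on_subset[OF torus_chart(3)[OF W]])
         auto
    have der: "(?f has_derivative (\<lambda>v. v)) (at x)" if x: "x \<in> ?S" for x
    proof -
      have "continuous_on ?S (\<lambda>y. ?f y - y)"
        by (rule continuous_on_diff[OF contf continuous_on_id])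
      then have "\<exists>d>0. \<forall>y\<in>?S. dist y x < d \<longrightarrow> dist (?f y - y) (?f x - x) < 1"
        unfolding continuous_on_iff using x zero_less_one by blast
      then obtain d where d: "d > 0" "\<And>y. y \<in> ?S \<Longrightarrow> dist y x < d \<Longrightarrow> dist (?f y - y) (?f x - x) < 1"
        by blast
      have eq: "?f y = y + (?f x - x)" if y: "y \<in> ?S \<inter> ball x d" for y
      proof -
        have "norm ((?f y - y) - (?f x - x)) < 1"
          using d(2)[of y] y by (simp add: dist_norm norm_minus_commute)
        moreover have "\<forall>i. ((?f y - y) - (?f x - x)) $ i \<in> \<int>"
          using int[of y] int[OF x] y by (auto intro: Ints_diff)
        ultimately have "(?f y - y) - (?f x - x) = 0"
          using norm_int_vec_ge_1[of "(?f y - y) - (?f x - x)"] by (meson not_le)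
        then show ?thesis by (simp add: algebra_simps)
      qed
      have 1: "((\<lambda>y. y + (?f x - x)) has_derivative (\<lambda>v. v)) (at x)"
        by (auto intro!: derivative_eq_intros)
      have 2: "open (?S \<inter> ball x d)" "x \<in> ?S \<inter> ball x d"
        using oS x d(1) by auto
      show ?thesis
        by (rule has_derivative_transform_within_open[OF 1 2]) (rule eq[symmetric])
    qed
    have "cont_diff_on m ?S ?f" for m
    proof (cases m)
      case (Suc m')
      have "cont_diff_on m' ?S (\<lambda>x. frechet_derivative ?f (at x) v)" for v
      proof (rule cont_diff_on_cong[OF oS _ cont_diff_on_const[of m' ?S v]])
        show "v = frechet_derivative ?f (at x) v" if "x \<in> ?S" for x
          using fun_cong[OF frechet_derivative_at[OF der[OF that]]] by simp
      qed
      moreover have "?f differentiable (at x)" if "x \<in> ?S" for x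
        using differentiableI[OF der[OF that]] .
      ultimately show ?thesis
        by (simp add: Suc)
    qed (use contf in simp)
    then have "cont_diff_on m ?S (the_inv_into W mod1 \<circ> the_inv_into (mod1 ` V) (the_inv_into V mod1))" for m
    proof (rule cont_diff_on_cong[OF oS, rotated])
      show "?f x = (the_inv_into W mod1 \<circ> the_inv_into (mod1 ` V) (the_inv_into V mod1)) x"
        if "x \<in> ?S" for x
        using that torus_chart(2)[OF V] by simp
    qed
    then show ?thesis
      by (simp add: Ck_on_def img)
  qed
  show ?thesis
    unfolding Ck_atlas_def
  proof (intro conjI)
    show "\<forall>c\<in>torus_atlas :: ('a torus, real^'a) chart set. is_chart c"
      using torus_chart(1) by (auto simp: torus_atlas_def)
    show "(\<Union>(U, \<phi>)\<in>(torus_atlas :: ('a torus, real^'a) chart set). U) = UNIV"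
      using cov by fastforce
    show "\<forall>(U, \<phi>)\<in>(torus_atlas :: ('a torus, real^'a) chart set). \<forall>(V, \<psi>)\<in>torus_atlas.
        Ck_on k (\<phi> ` (U \<inter> V)) (\<psi> \<circ> the_inv_into U \<phi>)"
      unfolding torus_atlas_def using trans by auto
  qed
qed

lemma Ck_manifold_torus: "Ck_manifold k torus_atlas"
  by (simp add: Ck_manifold_def Ck_atlas_torus)

definition Ck_flow ::
    "enat \<Rightarrow> ('a::topological_space, 'e::euclidean_space) chart set \<Rightarrow> (real \<Rightarrow> 'a \<Rightarrow> 'a) \<Rightarrow> bool" where
  "Ck_flow k A \<Phi> \<longleftrightarrow>
     (\<forall>x. \<Phi> 0 x = x) \<and>
     (\<forall>s t x. \<Phi> (s + t) x = \<Phi> s (\<Phi> t x)) \<and>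
     Ck_map k (prod_atlas std_atlas A) A (\<lambda>(t, x). \<Phi> t x)"

definition rationally_independent :: "real^'n::finite \<Rightarrow> bool" where
  "rationally_independent \<omega> \<longleftrightarrow>
     (\<forall>q :: 'n \<Rightarrow> rat. (\<Sum>i\<in>UNIV. of_rat (q i) * \<omega> $ i) = 0 \<longrightarrow> (\<forall>i. q i = 0))"

text \<open>
  The dimension \<open>m\<close> of the target is existentially quantified below, so it cannot be a type.
  Accordingly \<open>\<real>\<^sup>m\<close> is the library's \<open>Euclidean_space m\<close>, consisting of the
  \<open>x :: nat \<Rightarrow> real\<close> with \<open>x i = 0\<close> for \<open>i \<ge> m\<close>, and an \<open>m \<times> m\<close> matrix is a function
  \<open>nat \<Rightarrow> nat \<Rightarrow> real\<close> of which only the entries with indices below \<open>m\<close> are used.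
\<close>

primrec mat_power :: "nat \<Rightarrow> (nat \<Rightarrow> nat \<Rightarrow> real) \<Rightarrow> nat \<Rightarrow> (nat \<Rightarrow> nat \<Rightarrow> real)" where
  "mat_power m B 0 = (\<lambda>i j. if i = j then 1 else 0)"
| "mat_power m B (Suc p) = (\<lambda>i j. \<Sum>l<m. B i l * mat_power m B p l j)"

definition mat_exp :: "nat \<Rightarrow> (nat \<Rightarrow> nat \<Rightarrow> real) \<Rightarrow> (nat \<Rightarrow> nat \<Rightarrow> real)" where
  "mat_exp m B = (\<lambda>i j. \<Sum>p. mat_power m B p i j / fact p)"

definition linearizing :: "(real \<Rightarrow> 'a \<Rightarrow> 'a) \<Rightarrow> nat \<Rightarrow> ('a \<Rightarrow> nat \<Rightarrow> real) \<Rightarrow> bool" where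
  "linearizing \<Phi> m E \<longleftrightarrow>
     (\<exists>B :: nat \<Rightarrow> nat \<Rightarrow> real. \<forall>t x. \<forall>i<m.
        E (\<Phi> t x) i = (\<Sum>j<m. mat_exp m (\<lambda>a b. B a b * t) i j * E x j))"

text \<open>
  Smoothness into \<open>\<real>\<^sup>m\<close> is componentwise; the third conjunct says that the derivative of
  \<open>E\<close> is injective at every point, that is, that \<open>E\<close> is an immersion.
\<close>

definition Ck_embedding ::
    "enat \<Rightarrow> ('a::topological_space, 'e::euclidean_space) chart set \<Rightarrow> nat \<Rightarrow> ('a \<Rightarrow> nat \<Rightarrow> real) \<Rightarrow> bool" where
  "Ck_embedding k A m E \<longleftrightarrow>
     (\<forall>x. E x \<in> topspace (Euclidean_space m)) \<and>
     (\<forall>i<m. Ck_map k A std_atlas (\<lambda>x. E x i)) \<and>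
     (\<forall>(U, \<phi>)\<in>A. \<forall>p\<in>U. \<forall>v.
        (\<forall>i<m. frechet_derivative (\<lambda>z. E (the_inv_into U \<phi> z) i) (at (\<phi> p)) v = 0) \<longrightarrow> v = 0) \<and>
     embedding_map euclidean (Euclidean_space m) E"

definition linearizable_by_Ck_embedding ::
    "enat \<Rightarrow> ('a::topological_space, 'e::euclidean_space) chart set \<Rightarrow> (real \<Rightarrow> 'a \<Rightarrow> 'a) \<Rightarrow> bool" where
  "linearizable_by_Ck_embedding k A \<Phi> \<longleftrightarrow> (\<exists>m E. Ck_embedding k A m E \<and> linearizing \<Phi> m E)"

end

theory Submission
  imports Defs
begin

text \<open>
  The semi-conjugacy \<open>F\<close> to an irrational linear flow turns out to be a finite covering of the
  torus, and every finite covering of a torus by a connected space is again a torus, covering by an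
  integer matrix.

  \<^bold>\<open>\<open>F\<close> is a local diffeomorphism.\<close> Since \<open>\<Phi>\<^sup>t\<close> is a diffeomorphism and \<open>F\<close> intertwines it
  with a translation, the set \<open>C\<close> of critical points of \<open>F\<close> is flow-invariant; it is also closed,
  hence compact. So if \<open>C\<close> is nonempty, \<open>F(C)\<close> is closed and contains a full orbit of the
  linear flow, which is dense by Kronecker's theorem. Thus every point would be a critical
  value, contradicting Sard's theorem (\<open>all_regular\<close>). By the inverse function theorem, which preserves
  the class \<open>C\<^sup>k\<close> (\<open>cont_diff_on_inverse_function\<close>), \<open>F\<close> has local inverses of class \<open>C\<^sup>k\<close>.

  \<^bold>\<open>\<open>X\<close> is a torus.\<close> Instead of developing covering theory, one lifts the translations of the torus
  to \<open>X\<close>. By compactness there is a radius \<open>\<epsilon>\<close> for which translation by a vector \<open>w\<close> of norm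
  below \<open>\<epsilon>\<close> lifts at every point; uniqueness of lifts makes these short translations compose
  additively, and a long translation is an iterate of a short one (\<open>local_action_extends\<close>). This
  is an action \<open>P\<close> of \<open>\<real>\<^sup>n\<close> on \<open>X\<close> with open orbits, so it is transitive as \<open>X\<close> is connected.
  The stabilizer of a point over \<open>0\<close> is a subgroup of \<open>\<int>\<^sup>n\<close>, of full rank because the fibres of
  \<open>F\<close> are finite; hence it is \<open>M \<int>\<^sup>n\<close> for an integer matrix \<open>M\<close> of nonzero determinant
  (\<open>full_rank_sublattice_basis\<close>), and \<open>y \<mapsto> P (M y) x\<^sub>0\<close> induces the bijection \<open>\<psi>\<inverse>\<close> from \<open>T\<^sup>n\<close> to
  \<open>X\<close>. In charts \<open>\<psi>\<close> is \<open>M\<inverse> F\<close> up to a constant and \<open>\<psi>\<inverse>\<close> is a local inverse of \<open>F\<close> after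
  \<open>M\<close>, so both are \<open>C\<^sup>k\<close>. The flow \<open>\<Phi>\<^sup>t\<close> and the translation \<open>P (t \<omega>)\<close> lift the same curves, so
  they agree, and \<open>\<psi>\<close> carries them to the translation by \<open>t M\<inverse> \<omega>\<close>. The components of
  \<open>M\<inverse> \<omega>\<close> stay rationally independent because \<open>M\<inverse>\<close> is rational.

  \<^bold>\<open>Linearization.\<close> The functions \<open>cos (2 \<pi> \<psi>\<^sub>i)\<close> and \<open>sin (2 \<pi> \<psi>\<^sub>i)\<close> embed \<open>X\<close> into \<open>\<real>\<^sup>2\<^sup>n\<close>, where
  the flow acts by \<open>n\<close> plane rotations (\<open>torus_immersion_linearizable\<close>).
\<close>

section \<open>Maps of class C^m on open sets\<close>

lemma cont_diff_on_subset:
  assumes "cont_diff_on m S f" "T \<subseteq> S"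
  shows "cont_diff_on m T f"
  using assms by (induction m arbitrary: f) (auto intro: continuous_on_subset)

lemma cont_diff_on_SucI:
  assumes "open S" "\<And>x. x \<in> S \<Longrightarrow> (f has_derivative f' x) (at x)"
    and "\<And>v. cont_diff_on m S (\<lambda>x. f' x v)"
  shows "cont_diff_on (Suc m) S f"
proof -
  have "cont_diff_on m S (\<lambda>x. frechet_derivative f (at x) v)" for v
  proof (rule cont_diff_on_cong[OF assms(1) _ assms(3)])
    show "f' x v = frechet_derivative f (at x) v" if "x \<in> S" for x
      using frechet_derivative_at[OF assms(2)[OF that]] by simp
  qed
  then show ?thesis
    using assms(2) by (auto intro: differentiableI)
qed

lemma cont_diff_on_has_derivative:
  assumes "cont_diff_on (Suc m) S f" "x \<in> S"
  shows "(f has_derivative frechet_derivative f (at x)) (at x)"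
  using assms frechet_derivative_works by auto

lemma cont_diff_on_imp_continuous_on:
  assumes "cont_diff_on m S f"
  shows "continuous_on S f"
proof (cases m)
  case (Suc m')
  have "isCont f x" if "x \<in> S" for x
    using assms that by (intro differentiable_imp_continuous_within) (simp add: Suc)
  then show ?thesis
    by (simp add: continuous_at_imp_continuous_on)
qed (use assms in simp)

lemma cont_diff_on_SucD:
  assumes "cont_diff_on (Suc m) S f"
  shows "cont_diff_on m S f"
  using assms
proof (induction m arbitrary: f)
  case 0
  show ?case using cont_diff_on_imp_continuous_on[OF 0] by simp
next
  case (Suc m)
  then show ?case
    by (metis cont_diff_on.simps(2))
qed

lemma cont_diff_on_le:
  assumes "cont_diff_on m S f" "m' \<le> m"
  shows "cont_diff_on m' S f"
  using assms(2,1) by (induction rule: inc_induct) (auto dest: cont_diff_on_SucD simp del: cont_diff_on.simps)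

text \<open>
  Both continuity and differentiability at a point depend only on the germ there.
\<close>

lemma cont_diff_on_local:
  assumes "\<And>x. x \<in> S \<Longrightarrow> \<exists>T. open T \<and> x \<in> T \<and> cont_diff_on m (S \<inter> T) f"
  shows "cont_diff_on m S f"
  using assms
proof (induction m arbitrary: f)
  case 0
  show ?case
    unfolding cont_diff_on.simps continuous_on_eq_continuous_within
  proof
    fix x assume x: "x \<in> S"
    then obtain T where T: "open T" "x \<in> T" "continuous_on (S \<inter> T) f"
      using 0 by auto
    then have "continuous (at x within S \<inter> T) f"
      using x by (auto simp: continuous_on_eq_continuous_within)
    then show "continuous (at x within S) f"
      using at_within_nhd[OF T(2,1), of S "S \<inter> T"] by (simp add: Int_assoc)
  qed
next
  case (Suc m)
  have "cont_diff_on m S (\<lambda>x. frechet_derivative f (at x) v)" for v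
    by (rule Suc.IH) (use Suc.prems in fastforce)
  moreover have "f differentiable at x" if "x \<in> S" for x
    using Suc.prems[OF that] that by auto
  ultimately show ?case by simp
qed

lemma cont_diff_on_bounded_linear:
  assumes "bounded_linear L" "open S" "cont_diff_on m S f"
  shows "cont_diff_on m S (\<lambda>x. L (f x))"
  using assms(3)
proof (induction m arbitrary: f)
  case 0
  then show ?case
    using bounded_linear.continuous_on[OF assms(1)] by auto
next
  case (Suc m)
  show ?case
  proof (rule cont_diff_on_SucI[OF assms(2)])
    show "((\<lambda>x. L (f x)) has_derivative (\<lambda>v. L (frechet_derivative f (at x) v))) (at x)" if "x \<in> S" for x
      by (rule bounded_linear.has_derivative[OF assms(1) cont_diff_on_has_derivative[OF Suc.prems that]])
    show "cont_diff_on m S (\<lambda>x. L (frechet_derivative f (at x) v))" for v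
      by (rule Suc.IH) (use Suc.prems in simp)
  qed
qed

lemma cont_diff_on_add:
  assumes "open S" "cont_diff_on m S f" "cont_diff_on m S g"
  shows "cont_diff_on m S (\<lambda>x. f x + g x)"
  using assms(2,3)
proof (induction m arbitrary: f g)
  case 0
  then show ?case by (auto intro: continuous_on_add)
next
  case (Suc m)
  show ?case
  proof (rule cont_diff_on_SucI[OF assms(1)])
    show "((\<lambda>x. f x + g x) has_derivative
        (\<lambda>v. frechet_derivative f (at x) v + frechet_derivative g (at x) v)) (at x)" if "x \<in> S" for x
      by (intro has_derivative_add cont_diff_on_has_derivative[OF _ that]) (use Suc.prems in blast)+
    show "cont_diff_on m S (\<lambda>x. frechet_derivative f (at x) v + frechet_derivative g (at x) v)" for v
      by (rule Suc.IH) (use Suc.prems in simp_all)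
  qed
qed

lemma cont_diff_on_sum:
  assumes "open S" "\<And>i. i \<in> I \<Longrightarrow> cont_diff_on m S (f i)"
  shows "cont_diff_on m S (\<lambda>x. \<Sum>i\<in>I. f i x)"
  using assms(2)
proof (induction I rule: infinite_finite_induct)
  case (insert i I)
  then show ?case by (simp add: cont_diff_on_add[OF assms(1)])
qed (auto simp: cont_diff_on_const)

lemma cont_diff_on_bounded_bilinear:
  assumes "bounded_bilinear B" "open S" "cont_diff_on m S f" "cont_diff_on m S g"
  shows "cont_diff_on m S (\<lambda>x. B (f x) (g x))"
  using assms(3,4)
proof (induction m arbitrary: f g)
  case 0
  then show ?case
    using bounded_bilinear.continuous_on[OF assms(1)] by auto
next
  case (Suc m)
  note lower = Suc.prems[THEN cont_diff_on_SucD]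
  show ?case
  proof (rule cont_diff_on_SucI[OF assms(2)])
    show "((\<lambda>x. B (f x) (g x)) has_derivative
        (\<lambda>v. B (f x) (frechet_derivative g (at x) v) + B (frechet_derivative f (at x) v) (g x))) (at x)"
      if "x \<in> S" for x
      by (intro bounded_bilinear.FDERIV[OF assms(1)] cont_diff_on_has_derivative[OF _ that])
        (use Suc.prems in blast)+
    show "cont_diff_on m S
        (\<lambda>x. B (f x) (frechet_derivative g (at x) v) + B (frechet_derivative f (at x) v) (g x))" for v
      by (intro cont_diff_on_add[OF assms(2)] Suc.IH lower) (use Suc.prems in simp_all)
  qed
qed

lemmas cont_diff_on_mult = cont_diff_on_bounded_bilinear[OF bounded_bilinear_mult]

lemma cont_diff_on_prod:
  fixes f :: "'i \<Rightarrow> 'e::euclidean_space \<Rightarrow> real"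
  assumes "open S" "\<And>i. i \<in> I \<Longrightarrow> cont_diff_on m S (f i)"
  shows "cont_diff_on m S (\<lambda>x. \<Prod>i\<in>I. f i x)"
  using assms(2)
proof (induction I rule: infinite_finite_induct)
  case (insert i I)
  then show ?case by (simp add: cont_diff_on_mult[OF assms(1)])
qed (auto simp: cont_diff_on_const)

text \<open>
  The derivative is expanded in a basis, \<open>D(f \<circ> g)(x) v = \<Sum>\<^sub>b (Dg(x) v \<bullet> b) Df(g x) b\<close>: only then is
  it a sum of products of \<open>C\<^sup>m\<close> functions to which the induction hypothesis applies.
\<close>

lemma cont_diff_on_compose:
  fixes f :: "'e::euclidean_space \<Rightarrow> 'f::euclidean_space" and g :: "'d::euclidean_space \<Rightarrow> 'e"
  assumes "open S" "g ` S \<subseteq> T" "cont_diff_on m T f" "cont_diff_on m S g"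
  shows "cont_diff_on m S (\<lambda>x. f (g x))"
  using assms(3,4)
proof (induction m arbitrary: f)
  case 0
  then show ?case
    using continuous_on_compose2[OF _ _ assms(2)] by simp
next
  case (Suc m)
  let ?D = "\<lambda>x v. \<Sum>b\<in>Basis. (frechet_derivative g (at x) v \<bullet> b) *\<^sub>R frechet_derivative f (at (g x)) b"
  show ?case
  proof (rule cont_diff_on_SucI[OF assms(1)])
    fix x assume x: "x \<in> S"
    have f: "(f has_derivative frechet_derivative f (at (g x))) (at (g x))"
      by (rule cont_diff_on_has_derivative[OF Suc.prems(1)]) (use x assms(2) in auto)
    have "((\<lambda>x. f (g x)) has_derivative
        (\<lambda>v. frechet_derivative f (at (g x)) (frechet_derivative g (at x) v))) (at x)"
      using has_derivative_compose[OF cont_diff_on_has_derivative[OF Suc.prems(2) x] f] .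
    moreover have "frechet_derivative f (at (g x)) (frechet_derivative g (at x) v) = ?D x v" for v
    proof -
      interpret linear "frechet_derivative f (at (g x))"
        using has_derivative_linear[OF f] .
      show ?thesis
        by (subst euclidean_representation[symmetric, of "frechet_derivative g (at x) v"])
          (simp only: sum scale)
    qed
    ultimately show "((\<lambda>x. f (g x)) has_derivative ?D x) (at x)"
      by (simp only:)
  next
    fix v
    have "cont_diff_on m S (\<lambda>x. frechet_derivative g (at x) v \<bullet> b)" for b
      by (rule cont_diff_on_bounded_linear[OF bounded_linear_inner_left assms(1)])
        (use Suc.prems(2) in simp)
    moreover have "cont_diff_on m S (\<lambda>x. frechet_derivative f (at (g x)) b)" for b
      by (rule Suc.IH) (use Suc.prems cont_diff_on_SucD in auto)
    ultimately show "cont_diff_on m S (\<lambda>x. ?D x v)"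
      by (intro cont_diff_on_sum cont_diff_on_bounded_bilinear[OF bounded_bilinear_scaleR] assms(1))
  qed
qed

lemma cont_diff_on_id: "cont_diff_on m S (\<lambda>x. x)"
proof (cases m)
  case (Suc m')
  have "cont_diff_on m UNIV (\<lambda>x::'a. x)"
    unfolding Suc
    by (rule cont_diff_on_SucI[where f' = "\<lambda>_ v. v"]) (auto simp: cont_diff_on_const)
  then show ?thesis
    by (rule cont_diff_on_subset) simp
qed auto

lemma cont_diff_on_inverse:
  fixes f :: "'e::euclidean_space \<Rightarrow> real"
  assumes "open S" "\<And>x. x \<in> S \<Longrightarrow> f x \<noteq> 0" "cont_diff_on m S f"
  shows "cont_diff_on m S (\<lambda>x. inverse (f x))"
  using assms(3)
proof (induction m)
  case 0
  then show ?case using assms(2) by (auto intro: continuous_on_inverse)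
next
  case (Suc m)
  have inv: "cont_diff_on m S (\<lambda>x. inverse (f x))"
    using Suc cont_diff_on_SucD by blast
  show ?case
  proof (rule cont_diff_on_SucI[OF assms(1)])
    show "((\<lambda>x. inverse (f x)) has_derivative
        (\<lambda>v. (- 1) * (inverse (f x) * (frechet_derivative f (at x) v * inverse (f x))))) (at x)"
      if "x \<in> S" for x
      using Deriv.has_derivative_inverse[OF assms(2)[OF that] cont_diff_on_has_derivative[OF Suc.prems that]]
      by (simp add: mult.assoc)
    show "cont_diff_on m S (\<lambda>x. (- 1) * (inverse (f x) * (frechet_derivative f (at x) v * inverse (f x))))" for v
      by (intro cont_diff_on_mult assms(1) inv cont_diff_on_const) (use Suc.prems in simp)
  qed
qed

text \<open>
  Sine and cosine need a simultaneous induction, each being the derivative of the other.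
\<close>

lemma cont_diff_on_sin_cos:
  shows "cont_diff_on m UNIV (sin :: real \<Rightarrow> real)" and "cont_diff_on m UNIV (cos :: real \<Rightarrow> real)"
proof (induction m)
  case 0
  show "cont_diff_on 0 UNIV (sin :: real \<Rightarrow> real)" "cont_diff_on 0 UNIV (cos :: real \<Rightarrow> real)"
    by (auto intro!: continuous_intros)
next
  case (Suc m)
  show "cont_diff_on (Suc m) UNIV (sin :: real \<Rightarrow> real)"
  proof (rule cont_diff_on_SucI[where f' = "\<lambda>x v. cos x * v"])
    show "cont_diff_on m UNIV (\<lambda>x::real. cos x * v)" for v
      by (intro cont_diff_on_mult cont_diff_on_const Suc.IH) simp
  qed (auto intro!: derivative_eq_intros)
  show "cont_diff_on (Suc m) UNIV (cos :: real \<Rightarrow> real)"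
  proof (rule cont_diff_on_SucI[where f' = "\<lambda>x v. sin x * (- v)"])
    show "cont_diff_on m UNIV (\<lambda>x::real. sin x * (- v))" for v
      by (intro cont_diff_on_mult cont_diff_on_const Suc.IH) simp
  qed (auto intro!: derivative_eq_intros)
qed

lemma cont_diff_on_vec_iff:
  fixes f :: "'e::euclidean_space \<Rightarrow> real^'n"
  assumes "open S"
  shows "cont_diff_on m S f \<longleftrightarrow> (\<forall>i. cont_diff_on m S (\<lambda>x. f x $ i))"
proof
  show "\<forall>i. cont_diff_on m S (\<lambda>x. f x $ i)" if "cont_diff_on m S f"
    using cont_diff_on_bounded_linear[OF bounded_linear_vec_nth assms that] by blast
  assume *: "\<forall>i. cont_diff_on m S (\<lambda>x. f x $ i)"
  have "cont_diff_on m S (\<lambda>x. \<Sum>i\<in>UNIV. (f x $ i) *\<^sub>R (axis i 1 :: real^'n))"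
    using * by (intro cont_diff_on_sum cont_diff_on_bounded_bilinear[OF bounded_bilinear_scaleR]
        cont_diff_on_const assms) auto
  moreover have "(\<Sum>i\<in>UNIV. (f x $ i) *\<^sub>R (axis i 1 :: real^'n)) = f x" for x
    using basis_expansion[of "f x"] by (simp add: scalar_mult_eq_scaleR)
  ultimately show "cont_diff_on m S f" by simp
qed

lemma cont_diff_on_det:
  fixes a :: "'e::euclidean_space \<Rightarrow> real^'n^'n"
  assumes "open S" "\<And>i j. cont_diff_on m S (\<lambda>x. a x $ i $ j)"
  shows "cont_diff_on m S (\<lambda>x. det (a x))"
  unfolding det_def
  by (intro cont_diff_on_sum cont_diff_on_mult cont_diff_on_prod cont_diff_on_const assms)

text \<open>
  The inverse function theorem in class \<open>C\<^sup>m\<^sup>+\<^sup>1\<close>. By Cramer's rule the entries of \<open>Dh(y) = Df(h y)\<inverse>\<close> are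
  quotients of determinants in the entries of \<open>Df \<circ> h\<close>, so each order of smoothness of \<open>h\<close> yields
  the next one, up to that of \<open>f\<close>.
\<close>

lemma cont_diff_on_inverse_function:
  fixes f :: "real^'n \<Rightarrow> real^'n"
  assumes S: "open S" and T: "open T" "h ` T \<subseteq> S" "continuous_on T h" "\<And>y. y \<in> T \<Longrightarrow> f (h y) = y"
    and f: "cont_diff_on (Suc m) S f" "\<And>x. x \<in> S \<Longrightarrow> det (matrix (frechet_derivative f (at x))) \<noteq> 0"
  shows "cont_diff_on (Suc m) T h"
proof -
  define J where "J x = matrix (frechet_derivative f (at x))" for x
  define D where "D y v = (\<chi> k. det (\<chi> i j. if j = k then v $ i else J (h y) $ i $ j) * inverse (det (J (h y))))" for y v
  have hS: "h y \<in> S" if "y \<in> T" for y using that T(2) by auto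
  have der: "(h has_derivative D y) (at y)" if y: "y \<in> T" for y
  proof (rule has_derivative_inverse_basic[where f = f and T = T])
    show f': "(f has_derivative frechet_derivative f (at (h y))) (at (h y))"
      by (rule cont_diff_on_has_derivative[OF f(1) hS[OF y]])
    have D: "(J (h y) *v x = b) = (x = D y b)" for x b
      unfolding D_def using cramer[OF f(2)[OF hS[OF y]], of x b]
      unfolding J_def divide_inverse .
    have J: "J (h y) *v x = frechet_derivative f (at (h y)) x" for x
      using has_derivative_linear[OF f'] by (simp add: J_def)
    show "D y \<circ> frechet_derivative f (at (h y)) = id"
    proof
      show "(D y \<circ> frechet_derivative f (at (h y))) x = id x" for x
        using D[of x "J (h y) *v x"] by (simp add: J)
    qed
    have JD: "J (h y) *v D y b = b" for b
      using D by blast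
    have "linear (D y)"
    proof (rule linearI)
      show "D y (a + b) = D y a + D y b" for a b
        by (rule D[THEN iffD1, symmetric]) (simp only: matrix_vector_right_distrib JD)
      show "D y (r *\<^sub>R a) = r *\<^sub>R D y a" for r a
        by (rule D[THEN iffD1, symmetric]) (simp only: matrix_vector_mult_scaleR JD)
    qed
    then show "bounded_linear (D y)" by (rule linear_conv_bounded_linear[THEN iffD1])
    show "open T" "y \<in> T" by fact+
    show "continuous (at y) h"
      using T(1,3) y continuous_on_eq_continuous_at by blast
    show "f (h z) = z" if "z \<in> T" for z
      using T(4)[OF that] .
  qed
  have J: "cont_diff_on m S (\<lambda>x. J x $ i $ j)" for i j
  proof -
    have "cont_diff_on m S (\<lambda>x. frechet_derivative f (at x) (axis j 1))"
      using f(1) by simp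
    from cont_diff_on_bounded_linear[OF bounded_linear_vec_nth S this]
    show ?thesis
      by (simp add: J_def matrix_def)
  qed
  have "cont_diff_on m' T h \<Longrightarrow> m' \<le> m \<Longrightarrow> cont_diff_on (Suc m') T h" for m'
  proof (rule cont_diff_on_SucI[OF T(1) der])
    fix v assume h: "cont_diff_on m' T h" and "m' \<le> m"
    then have "cont_diff_on m' S (\<lambda>x. J x $ i $ j)" for i j
      using cont_diff_on_le[OF J] by blast
    then have Jh: "cont_diff_on m' T (\<lambda>y. J (h y) $ i $ j)" for i j
      using cont_diff_on_compose[OF T(1,2) _ h] by blast
    have entry: "cont_diff_on m' T (\<lambda>y. (\<chi> i j. if j = k then v $ i else J (h y) $ i $ j) $ i $ j)" for i j k
      by (cases "j = k") (simp_all add: Jh cont_diff_on_const)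
    show "cont_diff_on m' T (\<lambda>y. D y v)"
      unfolding cont_diff_on_vec_iff[OF T(1)] D_def vec_lambda_beta
    proof (intro allI cont_diff_on_mult[OF T(1)] cont_diff_on_inverse[OF T(1)] cont_diff_on_det[OF T(1)] entry Jh)
      show "det (J (h y)) \<noteq> 0" if "y \<in> T" for y
        using f(2) hS[OF that] by (simp add: J_def)
    qed
  qed
  then have "m' \<le> Suc m \<Longrightarrow> cont_diff_on m' T h" for m'
    by (induction m') (use T(3) in auto)
  then show ?thesis by blast
qed

section \<open>Lifting the translations of the torus\<close>

lemma Hausdorff_space_t2: "Hausdorff_space (euclidean :: 'a::t2_space topology)"
  unfolding Hausdorff_space_def disjnt_def using hausdorff by auto

text \<open>
  The coincidence set of two lifts is closed because the target is Hausdorff, and open because \<open>F\<close>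
  is locally injective.
\<close>

lemma unique_lift:
  fixes a b :: "'e::topological_space \<Rightarrow> 'a::t2_space"
  assumes inj: "\<And>x. \<exists>N. open N \<and> x \<in> N \<and> inj_on F N"
    and S: "connected S" "continuous_on S a" "continuous_on S b" "\<And>s. s \<in> S \<Longrightarrow> F (a s) = F (b s)"
    and "s\<^sub>0 \<in> S" "a s\<^sub>0 = b s\<^sub>0" "s \<in> S"
  shows "a s = b s"
proof -
  let ?E = "{s \<in> S. a s = b s}"
  have "openin (top_of_set S) ?E"
  proof (subst openin_subopen, intro ballI)
    fix s assume "s \<in> ?E"
    then obtain N where N: "open N" "a s \<in> N" "inj_on F N"
      using inj by blast
    let ?T = "(S \<inter> a -` N) \<inter> (S \<inter> b -` N)"
    have "openin (top_of_set S) ?T"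
      by (intro openin_Int continuous_openin_preimage_gen S N)
    moreover have "s \<in> ?T" "?T \<subseteq> ?E"
      using \<open>s \<in> ?E\<close> N S(4) by (auto dest: inj_onD)
    ultimately show "\<exists>T. openin (top_of_set S) T \<and> s \<in> T \<and> T \<subseteq> ?E"
      by blast
  qed
  moreover have "closedin (top_of_set S) ?E"
    using closedin_continuous_maps_eq[OF Hausdorff_space_t2, of "top_of_set S" a b] S
    by simp
  ultimately have "?E = {} \<or> ?E = S"
    using S(1) connected_clopen by blast
  then show ?thesis
    using assms(6-8) by blast
qed

text \<open>
  The action of a long vector \<open>v\<close> is the \<open>n\<close>-th iterate of the action of \<open>v / n\<close>, for any \<open>n\<close>
  that makes \<open>v / n\<close> short enough. Two choices of \<open>n\<close> agree as both agree with their product,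
  and additivity is inherited because short translations commute.
\<close>

lemma local_action_extends:
  fixes T :: "'v::real_normed_vector \<Rightarrow> 'a \<Rightarrow> 'a"
  assumes "\<epsilon> > 0" and T0: "\<And>x. T 0 x = x"
    and T_add: "\<And>u v x. norm u + norm v < \<epsilon> \<Longrightarrow> T u (T v x) = T (u + v) x"
  obtains P where "\<And>u v x. P u (P v x) = P (u + v) x" "\<And>v x. norm v < \<epsilon> \<Longrightarrow> P v x = T v x"
proof -
  define N where "N v = nat \<lceil>norm v / \<epsilon>\<rceil> + 1" for v :: 'v
  define P where "P v = (T (v /\<^sub>R real (N v)) ^^ N v)" for v
  have multiple: "(T a ^^ K) = T (real K *\<^sub>R a)" if "real K * norm a < \<epsilon>" for a K
    using that
  proof (induction K)
    case 0
    then show ?case by (simp add: T0 fun_eq_iff)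
  next
    case (Suc K)
    then have "real K * norm a < \<epsilon>" "norm a + norm (real K *\<^sub>R a) < \<epsilon>"
      by (simp_all add: algebra_simps) (smt (verit) norm_ge_zero)
    then show ?case
      using Suc.IH T_add by (simp add: fun_eq_iff algebra_simps)
  qed
  have N: "norm v < real (N v) * \<epsilon>" for v
  proof -
    have "norm v / \<epsilon> < real (N v)"
      unfolding N_def using \<open>\<epsilon> > 0\<close> by linarith
    then show ?thesis
      using \<open>\<epsilon> > 0\<close> by (simp add: field_simps)
  qed
  \<comment> \<open>Subdividing the steps further changes nothing; applied twice, this compares any two step numbers.\<close>
  have refine: "(T (v /\<^sub>R real n) ^^ n) = (T (v /\<^sub>R real (n * m)) ^^ (n * m))"
    if "norm v < real n * \<epsilon>" "m > 0" for v n m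
  proof -
    have "n > 0" using that(1) by (cases n) (auto simp: not_less)
    have "real m * norm (v /\<^sub>R real (n * m)) < \<epsilon>"
      using that \<open>n > 0\<close> by (simp add: field_simps)
    then have "(T (v /\<^sub>R real (n * m)) ^^ m) = T (v /\<^sub>R real n)"
      using multiple[of m "v /\<^sub>R real (n * m)"] \<open>n > 0\<close> \<open>m > 0\<close> by (simp add: field_simps)
    then show ?thesis
      by (metis funpow_mult mult.commute)
  qed
  have P: "P v = (T (v /\<^sub>R real n) ^^ n)" if "norm v < real n * \<epsilon>" for v n
  proof -
    have "n > 0" using that by (cases n) (auto simp: not_less)
    then show ?thesis
      using refine[OF N[of v], of n] refine[OF that, of "N v"]
      by (simp add: P_def mult.commute N_def)
  qed
  have "P u (P v x) = P (u + v) x" for u v x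
  proof -
    obtain n where n: "norm u + norm v < real n * \<epsilon>"
      using \<open>\<epsilon> > 0\<close> ex_less_of_nat_mult by blast
    then have "n > 0" using norm_ge_zero[of u] norm_ge_zero[of v] by (cases n) auto
    let ?u = "u /\<^sub>R real n" and ?v = "v /\<^sub>R real n"
    have small: "norm ?u + norm ?v < \<epsilon>"
      using n \<open>n > 0\<close> by (simp add: field_simps)
    have uv: "T ?u \<circ> T ?v = T ((u + v) /\<^sub>R real n)"
      using T_add[OF small] by (simp add: fun_eq_iff scaleR_add_right)
    have "T ?v \<circ> T ?u = T ((u + v) /\<^sub>R real n)"
      using T_add[of ?v ?u] small by (simp add: fun_eq_iff scaleR_add_right add.commute)
    then have comm: "T ?u \<circ> T ?v = T ?v \<circ> T ?u"
      using uv by simp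
    have "((T ?u \<circ> T ?v) ^^ m) = (T ?u ^^ m) \<circ> (T ?v ^^ m)" for m
    proof (induction m)
      case (Suc m)
      have "T ?v \<circ> (T ?u ^^ m) = (T ?u ^^ m) \<circ> T ?v"
      proof (induction m)
        case (Suc m)
        then show ?case
          using comm by (metis comp_assoc funpow.simps(2))
      qed simp
      then show ?case
        using Suc by (simp add: fun_eq_iff)
    qed simp
    moreover have "norm u < real n * \<epsilon>" "norm v < real n * \<epsilon>" "norm (u + v) < real n * \<epsilon>"
      using n norm_ge_zero[of u] norm_ge_zero[of v] norm_triangle_ineq[of u v] by linarith+
    ultimately show ?thesis
      by (metis P uv comp_apply)
  qed
  moreover have "P v x = T v x" if "norm v < \<epsilon>" for v x
    using P[of v 1] that by simp
  ultimately show ?thesis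
    using that by blast
qed

lemma mod1_add: "mod1 (x + y) = mod1 x + mod1 y"
  by (simp add: plus_torus.abs_eq)

lemma torus_add_assoc: "a + b + c = a + (b + c)" for a b c :: "'n::finite torus"
proof -
  obtain x y z where "a = mod1 x" "b = mod1 y" "c = mod1 z"
    by (metis surj_mod1)
  then show ?thesis by (simp add: add.assoc flip: mod1_add)
qed

lemma torus_add_commute: "a + b = b + a" for a b :: "'n::finite torus"
proof -
  obtain x y where "a = mod1 x" "b = mod1 y"
    by (metis surj_mod1)
  then show ?thesis by (simp add: add.commute flip: mod1_add)
qed

lemma torus_mod1_zero_add: "mod1 0 + a = a"
proof -
  obtain x where "a = mod1 x" by (metis surj_mod1)
  then show ?thesis by (simp flip: mod1_add)
qed

lemma torus_add_left_cancel: "a + b = a + c \<longleftrightarrow> b = c" for a b c :: "'n::finite torus"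
proof -
  obtain x y z where "a = mod1 x" "b = mod1 y" "c = mod1 z"
    by (metis surj_mod1)
  then show ?thesis by (simp add: mod1_eq_iff flip: mod1_add)
qed

text \<open>
  A local inverse of \<open>F\<close> at \<open>x\<close>, in coordinates centred at \<open>F x\<close>: it realises short translations
  of the torus as motions of the point \<open>x\<close>. Openness of \<open>\<sigma>\<close> makes these motions reach a whole
  neighbourhood of \<open>x\<close>.
\<close>

definition local_section :: "('a::topological_space \<Rightarrow> 'n::finite torus) \<Rightarrow> 'a \<Rightarrow> real \<Rightarrow> (real^'n \<Rightarrow> 'a) \<Rightarrow> bool" where
  "local_section F x r \<sigma> \<longleftrightarrow> r > 0 \<and> continuous_on (ball 0 r) \<sigma> \<and> \<sigma> 0 = x \<and>
     (\<forall>w\<in>ball 0 r. F (\<sigma> w) = mod1 w + F x) \<and> (\<forall>W. open W \<longrightarrow> W \<subseteq> ball 0 r \<longrightarrow> open (\<sigma> ` W))"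

lemma local_section_recentre:
  assumes "local_section F x r \<sigma>" "v \<in> ball 0 r" "e > 0" "norm v + e \<le> r"
  shows "local_section F (\<sigma> v) e (\<lambda>w. \<sigma> (v + w))"
proof -
  have sub: "v + w \<in> ball 0 r" if "w \<in> ball 0 e" for w
    using that assms(4) norm_triangle_ineq[of v w] by simp
  have "continuous_on (ball 0 e) (\<lambda>w. \<sigma> (v + w))"
  proof (rule continuous_on_compose2[of "ball 0 r" \<sigma>])
    show "(+) v ` ball 0 e \<subseteq> ball 0 r"
      using sub by blast
  qed (use assms(1) in \<open>auto simp: local_section_def intro!: continuous_intros\<close>)
  moreover have "open ((\<lambda>w. \<sigma> (v + w)) ` W)" if "open W" "W \<subseteq> ball 0 e" for W
  proof -
    have "open (\<sigma> ` ((+) v ` W))"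
      using assms(1) sub that open_translation[OF that(1)] unfolding local_section_def by blast
    then show ?thesis by (simp add: image_image)
  qed
  moreover have "F (\<sigma> (v + w)) = mod1 w + F (\<sigma> v)" if "w \<in> ball 0 e" for w
  proof -
    have "F (\<sigma> (v + w)) = mod1 (w + v) + F x" "F (\<sigma> v) = mod1 v + F x"
      using assms(1,2) sub[OF that] by (auto simp: local_section_def add.commute)
    then show ?thesis
      by (simp add: mod1_add torus_add_assoc)
  qed
  ultimately show ?thesis
    using assms(3) by (simp add: local_section_def)
qed

text \<open>
  A Lebesgue number argument: finitely many sections, restricted to half their radii, cover the
  compact space, and a section of radius \<open>r\<close> may be recentred at any point of its half ball with
  radius \<open>r / 2\<close>.
\<close>

lemma local_sections_uniform:
  fixes F :: "'a::t2_space \<Rightarrow> 'n::finite torus"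
  assumes "compact (UNIV :: 'a set)" "\<And>x. \<exists>r \<sigma>. local_section F x r \<sigma>"
  obtains \<epsilon> \<sigma> where "\<epsilon> > 0" "\<And>x. local_section F x \<epsilon> (\<sigma> x)"
proof -
  obtain r \<sigma> where s: "\<And>x. local_section F x (r x) (\<sigma> x)"
    using assms(2) by metis
  have r: "r x > 0" for x
    using s by (simp add: local_section_def)
  define B where "B x = \<sigma> x ` ball 0 (r x / 2)" for x
  have "open (B x)" if "x \<in> UNIV" for x
  proof -
    have "ball 0 (r x / 2) \<subseteq> (ball 0 (r x) :: (real^'n) set)"
      using r[of x] by (intro subset_ball) simp
    then show ?thesis
      using s[of x] unfolding B_def local_section_def by blast
  qed
  moreover have "x \<in> B x" for x
    using s[of x] r[of x] unfolding B_def local_section_def by (intro image_eqI[of _ _ 0]) auto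
  then have "UNIV \<subseteq> (\<Union>x\<in>UNIV. B x)"
    by blast
  ultimately obtain D where D: "finite D" "UNIV \<subseteq> (\<Union>x\<in>D. B x)"
    by (rule compactE_image[OF assms(1)])
  then have "D \<noteq> {}" by auto
  define \<epsilon> where "\<epsilon> = Min (r ` D) / 2"
  have "\<epsilon> > 0" "\<And>x. x \<in> D \<Longrightarrow> \<epsilon> \<le> r x / 2"
    using D(1) \<open>D \<noteq> {}\<close> r by (auto simp: \<epsilon>_def)
  moreover have "\<exists>\<sigma>'. local_section F y \<epsilon> \<sigma>'" for y
  proof -
    obtain x v where x: "x \<in> D" "y = \<sigma> x v" "norm v < r x / 2"
      using subsetD[OF D(2) UNIV_I[of y]] by (auto simp: B_def)
    then show ?thesis
      using local_section_recentre[OF s[of x], of v \<epsilon>] \<open>\<epsilon> > 0\<close> \<open>x \<in> D \<Longrightarrow> \<epsilon> \<le> r x / 2\<close> r[of x] by auto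
  qed
  ultimately show ?thesis
    using that by metis
qed

text \<open>
  An action of \<open>\<real>\<^sup>n\<close> by lifts of the translations of the torus. Only continuity and openness of the
  orbit maps are recorded, since this is all that the orbit structure needs.
\<close>

definition lifted_translations :: "('a::topological_space \<Rightarrow> 'n::finite torus) \<Rightarrow> (real^'n \<Rightarrow> 'a \<Rightarrow> 'a) \<Rightarrow> bool" where
  "lifted_translations F P \<longleftrightarrow>
     (\<forall>x. P 0 x = x) \<and> (\<forall>u v x. P u (P v x) = P (u + v) x) \<and> (\<forall>v x. F (P v x) = mod1 v + F x) \<and>
     (\<forall>x. continuous_on UNIV (\<lambda>v. P v x)) \<and> (\<forall>x W. open W \<longrightarrow> open ((\<lambda>v. P v x) ` W))"

lemma lifted_translations_exist:
  fixes F :: "'a::t2_space \<Rightarrow> 'n::finite torus"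
  assumes "compact (UNIV :: 'a set)" and sec: "\<And>x. \<exists>r \<sigma>. local_section F x r \<sigma>"
    and inj: "\<And>x. \<exists>N. open N \<and> x \<in> N \<and> inj_on F N"
  obtains P where "lifted_translations F P"
proof -
  obtain \<epsilon> \<sigma> where \<epsilon>: "\<epsilon> > 0" and s: "\<And>x. local_section F x \<epsilon> (\<sigma> x)"
    using local_sections_uniform[OF assms(1) sec] by blast
  define T where "T w x = \<sigma> x w" for w x
  have T0: "T 0 x = x" for x
    using s by (simp add: T_def local_section_def)
  have FT: "F (T w x) = mod1 w + F x" if "norm w < \<epsilon>" for w x
    using s that by (simp add: T_def local_section_def)
  have contT: "continuous_on (ball 0 \<epsilon>) (\<lambda>w. T w x)" for x
    using s by (simp add: T_def local_section_def)
  have T_add: "T u (T v x) = T (u + v) x" if "norm u + norm v < \<epsilon>" for u v x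
  proof (rule unique_lift[OF inj, where S = "ball 0 (\<epsilon> - norm v)"
        and a = "\<lambda>u. T u (T v x)" and b = "\<lambda>u. T (u + v) x"])
    have sub: "norm (w + v) < \<epsilon>" if "w \<in> ball 0 (\<epsilon> - norm v)" for w
      using that norm_triangle_ineq[of w v] by simp
    show "continuous_on (ball 0 (\<epsilon> - norm v)) (\<lambda>u. T u (T v x))"
      by (rule continuous_on_subset[OF contT]) (simp add: subset_ball)
    show "continuous_on (ball 0 (\<epsilon> - norm v)) (\<lambda>u. T (u + v) x)"
      by (rule continuous_on_compose2[OF contT]) (use sub in \<open>auto intro!: continuous_intros\<close>)
    show "F (T w (T v x)) = F (T (w + v) x)" if "w \<in> ball 0 (\<epsilon> - norm v)" for w
    proof -
      have "norm w < \<epsilon>" "norm v < \<epsilon>"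
        using that norm_ge_zero[of v] norm_ge_zero[of w] by (simp_all, linarith+)
      then show ?thesis
        using sub[OF that] by (simp add: FT mod1_add torus_add_assoc)
    qed
    show "0 \<in> ball 0 (\<epsilon> - norm v)" "u \<in> ball 0 (\<epsilon> - norm v)"
      using that norm_ge_zero[of u] by (simp_all, linarith)
  qed (auto simp: T0)
  obtain P where P_add: "\<And>u v x. P u (P v x) = P (u + v) x"
    and PT: "\<And>v x. norm v < \<epsilon> \<Longrightarrow> P v x = T v x"
    using local_action_extends[of \<epsilon> T, OF \<epsilon> T0 T_add] by blast
  have P0: "P 0 x = x" for x
    using PT[of 0] \<epsilon> T0 by simp
  have near: "P (v + w) x = T w (P v x)" if "norm w < \<epsilon>" for v w x
    using PT[OF that] P_add by (metis add.commute)
  have mult: "F (P (real n *\<^sub>R w) x) = mod1 (real n *\<^sub>R w) + F x" if "norm w < \<epsilon>" for n w x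
  proof (induction n)
    case 0
    show ?case by (simp add: P0 torus_mod1_zero_add)
  next
    case (Suc n)
    have "P (real (Suc n) *\<^sub>R w) x = T w (P (real n *\<^sub>R w) x)"
      using near[OF that, of "real n *\<^sub>R w" x] by (simp add: algebra_simps)
    then show ?case
      using Suc by (simp add: FT[OF that] scaleR_add_left mod1_add torus_add_assoc)
  qed
  have FP: "F (P v x) = mod1 v + F x" for v x
  proof -
    obtain n where n: "norm v < real n * \<epsilon>"
      using \<epsilon> ex_less_of_nat_mult by blast
    then have "n > 0" by (cases n) (auto simp: not_less)
    then show ?thesis
      using mult[of "v /\<^sub>R real n" n x] n by (simp add: field_simps)
  qed
  have "isCont (\<lambda>v. P v x) v" for x v
  proof -
    have "continuous_on (ball v \<epsilon>) (\<lambda>u. T (u - v) (P v x))"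
      by (rule continuous_on_compose2[OF contT])
        (auto simp: dist_norm norm_minus_commute intro!: continuous_intros)
    then have "continuous_on (ball v \<epsilon>) (\<lambda>u. P u x)"
      by (rule continuous_on_eq) (use near[of "_ - v" v x] in \<open>auto simp: dist_norm norm_minus_commute\<close>)
    then show ?thesis
      using \<epsilon> by (simp add: continuous_on_eq_continuous_at)
  qed
  then have contP: "continuous_on UNIV (\<lambda>v. P v x)" for x
    by (simp add: continuous_on_eq_continuous_at)
  have "open ((\<lambda>v. P v x) ` W)" if "open W" for x W
  proof (subst open_subopen, intro ballI)
    fix y assume "y \<in> (\<lambda>v. P v x) ` W"
    then obtain v where v: "v \<in> W" "y = P v x" by blast
    obtain d\<^sub>0 where d\<^sub>0: "d\<^sub>0 > 0" "ball v d\<^sub>0 \<subseteq> W"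
      using openE[OF \<open>open W\<close> v(1)] by blast
    define d where "d = min d\<^sub>0 \<epsilon>"
    have d: "d > 0" "ball v d \<subseteq> W" "d \<le> \<epsilon>"
      using d\<^sub>0 \<epsilon> by (auto simp: d_def)
    let ?O = "(\<lambda>w. T w y) ` ball 0 d"
    have "open ?O"
      using s[of y] d unfolding local_section_def T_def by (simp add: subset_ball)
    moreover have "y \<in> ?O"
      using d(1) T0 by (metis centre_in_ball image_eqI)
    moreover have "?O \<subseteq> (\<lambda>v. P v x) ` W"
    proof
      fix z assume "z \<in> ?O"
      then obtain w where w: "norm w < d" "z = T w y" by auto
      then have "z = P (v + w) x" using near[of w v x] d(3) v(2) by simp
      moreover have "v + w \<in> W" using d(2) w(1) by (auto simp: dist_norm)
      ultimately show "z \<in> (\<lambda>v. P v x) ` W" by blast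
    qed
    ultimately show "\<exists>T. open T \<and> y \<in> T \<and> T \<subseteq> (\<lambda>v. P v x) ` W" by blast
  qed
  then have "lifted_translations F P"
    using P0 P_add FP contP by (simp add: lifted_translations_def)
  then show ?thesis
    by (rule that)
qed

text \<open>
  Orbits are open and partition the space, so each is clopen.
\<close>

lemma lifted_translations_transitive:
  fixes F :: "'a::topological_space \<Rightarrow> 'n::finite torus"
  assumes "lifted_translations F P" "connected (UNIV :: 'a set)"
  obtains v where "P v x = y"
proof -
  let ?orb = "\<lambda>x. range (\<lambda>v. P v x)"
  have op: "open (?orb x)" for x
    using assms(1) by (simp add: lifted_translations_def)
  have self: "x \<in> ?orb x" for x
    using assms(1) by (metis lifted_translations_def rangeI)
  have "- ?orb x = (\<Union>z\<in>- ?orb x. ?orb z)"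
  proof
    show "(\<Union>z\<in>- ?orb x. ?orb z) \<subseteq> - ?orb x"
    proof (clarsimp)
      fix z u v assume z: "z \<notin> ?orb x" and eq: "P v z = P u x"
      have "P (- v + v) z = P (- v + u) x"
        using assms(1) eq unfolding lifted_translations_def by metis
      then have "z = P (- v + u) x"
        using assms(1) unfolding lifted_translations_def by simp
      then show False using z by blast
    qed
  qed (use self in blast)
  then have "open (- ?orb x)"
    using op by (metis open_UN)
  then have "?orb x = UNIV"
    using assms(2) op[of x] self[of x] connected_clopen[of UNIV] by (auto simp: closed_def)
  then show ?thesis
    using that by (metis UNIV_I imageE)
qed

text \<open>
  Finitely many sets on which \<open>F\<close> is injective cover the space, and each meets a fibre at most once.
\<close>

lemma finite_fibre:
  fixes F :: "'a::t2_space \<Rightarrow> 'b::t2_space"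
  assumes "compact (UNIV :: 'a set)" "continuous_on UNIV F"
    and inj: "\<And>x. \<exists>N. open N \<and> x \<in> N \<and> inj_on F N"
  shows "finite {x. F x = c}"
proof -
  obtain N where N: "\<And>x. open (N x)" "\<And>x. x \<in> N x" "\<And>x. inj_on F (N x)"
    using inj by metis
  then obtain D where D: "finite D" "UNIV \<subseteq> (\<Union>x\<in>D. N x)"
    using compactE_image[OF assms(1), of UNIV N] by (metis UNIV_I UN_I subsetI)
  have "{x. F x = c} \<subseteq> (\<Union>y\<in>D. {x \<in> N y. F x = c})"
    using D(2) by auto
  moreover have "finite {x \<in> N y. F x = c}" for y
  proof (cases "{x \<in> N y. F x = c} = {}")
    case False
    then obtain z where z: "z \<in> N y" "F z = c" by blast
    then have "{x \<in> N y. F x = c} \<subseteq> {z}" using N(3)[of y] by (auto dest: inj_onD)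
    then show ?thesis using finite_subset by blast
  next
    case True
    then show ?thesis by (metis finite.emptyI)
  qed
  ultimately show ?thesis
    using D(1) finite_subset by blast
qed

text \<open>
  Integer translations permute the finite fibre of \<open>x\<^sub>0\<close>, so along each axis some multiple returns
  to \<open>x\<^sub>0\<close>; the product of these multiples serves for all axes at once.
\<close>

lemma stabilizer_full_rank:
  fixes F :: "'a::t2_space \<Rightarrow> 'n::finite torus"
  assumes P: "lifted_translations F P" and fin: "finite {x. F x = F x\<^sub>0}"
  obtains d :: nat where "d > 0" "\<And>i. P (real d *\<^sub>R axis i 1) x\<^sub>0 = x\<^sub>0"
proof -
  note P' = P[unfolded lifted_translations_def]
  have period: "P (real (m * k) *\<^sub>R v) x\<^sub>0 = x\<^sub>0" if "P (real k *\<^sub>R v) x\<^sub>0 = x\<^sub>0" for m k v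
  proof (induction m)
    case (Suc m)
    have "P (real (Suc m * k) *\<^sub>R v) x\<^sub>0 = P (real (m * k) *\<^sub>R v) (P (real k *\<^sub>R v) x\<^sub>0)"
      using P' by (simp add: algebra_simps)
    then show ?case using Suc that by simp
  qed (use P' in simp)
  have "\<exists>k>0. P (real k *\<^sub>R axis i 1) x\<^sub>0 = x\<^sub>0" for i
  proof -
    let ?p = "\<lambda>k::nat. P (real k *\<^sub>R axis i 1) x\<^sub>0"
    have "mod1 (real k *\<^sub>R axis i 1 :: real^'n) = mod1 0" for k
      by (simp add: mod1_eq_iff axis_def)
    then have "range ?p \<subseteq> {x. F x = F x\<^sub>0}"
      using P' by (auto simp: torus_mod1_zero_add)
    then have "\<not> inj ?p"
      using fin finite_subset range_inj_infinite by blast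
    then obtain a b where "a \<noteq> b" "?p a = ?p b"
      unfolding inj_def by blast
    then obtain k l where "k < l" "?p k = ?p l"
      by (cases "a < b") (force, metis linorder_neqE_nat)
    then have "P (- (real k *\<^sub>R axis i 1)) (?p k) = P (- (real k *\<^sub>R axis i 1)) (?p l)"
      by simp
    then have "P (- (real k *\<^sub>R axis i 1) + real k *\<^sub>R axis i 1) x\<^sub>0 = P (- (real k *\<^sub>R axis i 1) + real l *\<^sub>R axis i 1) x\<^sub>0"
      using P' by simp
    moreover have "- (real k *\<^sub>R axis i 1) + real l *\<^sub>R axis i 1 = real (l - k) *\<^sub>R (axis i 1 :: real^'n)"
      using \<open>k < l\<close> by (simp add: of_nat_diff algebra_simps)
    ultimately have "?p (l - k) = x\<^sub>0" using P' by simp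
    then show ?thesis using \<open>k < l\<close> by (intro exI[of _ "l - k"]) simp
  qed
  then obtain k where k: "\<And>i. k i > 0" "\<And>i. P (real (k i) *\<^sub>R axis i 1) x\<^sub>0 = x\<^sub>0"
    by metis
  have "P (real (\<Prod>j\<in>UNIV. k j) *\<^sub>R axis i 1) x\<^sub>0 = x\<^sub>0" for i
    using period[OF k(2)[of i], of "\<Prod>j\<in>UNIV - {i}. k j"]
    by (subst prod.remove[of UNIV i]) (simp_all add: mult.commute)
  moreover have "(\<Prod>j\<in>UNIV. k j) > 0" using k(1) by (simp add: prod_pos)
  ultimately show ?thesis using that by blast
qed

section \<open>Lattices of full rank and rational independence\<close>

lemma det_Ints:
  assumes "\<And>i j. a $ i $ j \<in> \<int>"
  shows "det (a :: real^'n^'n) \<in> \<int>"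
  unfolding det_def by (intro Ints_sum Ints_mult Ints_prod Ints_of_int assms)

lemma det_Rats:
  assumes "\<And>i j. a $ i $ j \<in> \<rat>"
  shows "det (a :: real^'n^'n) \<in> \<rat>"
  unfolding det_def by (intro Rats_sum Rats_mult Rats_prod Rats_of_int assms)

text \<open>
  The columns of \<open>M\<close> are \<open>n\<close> vectors of the lattice whose determinant has least nonzero absolute
  value, which exists because determinants of lattice vectors are integers. If a lattice vector had a
  non-integral coordinate in this basis, then subtracting integer parts leaves a lattice vector
  with a coordinate strictly between \<open>0\<close> and \<open>1\<close>, and exchanging it for the corresponding
  column would decrease the determinant by exactly this factor (Cramer's rule).
\<close>

lemma full_rank_sublattice_basis:
  fixes L :: "(real^'n) set"
  assumes "d > 0" "\<And>i. real d *\<^sub>R axis i 1 \<in> L"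
    and int: "\<And>l i. l \<in> L \<Longrightarrow> l $ i \<in> \<int>"
    and grp: "0 \<in> L" "\<And>l m. l \<in> L \<Longrightarrow> m \<in> L \<Longrightarrow> l + m \<in> L" "\<And>l. l \<in> L \<Longrightarrow> - l \<in> L"
  obtains M :: "int^'n^'n" where "invertible (map_matrix real_of_int M)"
    "\<forall>y. map_matrix real_of_int M *v y \<in> L \<longleftrightarrow> (\<forall>i. y $ i \<in> \<int>)"
proof -
  have nat_mult: "real k *\<^sub>R l \<in> L" if "l \<in> L" for k l
    by (induction k) (use that grp in \<open>auto simp: scaleR_add_left\<close>)
  have int_mult: "c *\<^sub>R l \<in> L" if l: "l \<in> L" and "c \<in> \<int>" for c l
  proof -
    from \<open>c \<in> \<int>\<close> obtain k where "c = real k \<or> c = - real k"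
      by (metis Ints_cases int_cases2 of_int_minus of_int_of_nat_eq)
    then show ?thesis using nat_mult[OF l, of k] grp(3) by auto
  qed
  have sum: "(\<Sum>i\<in>I. g i) \<in> L" if "\<And>i. i \<in> I \<Longrightarrow> g i \<in> L" for g :: "'n \<Rightarrow> real^'n" and I
    using that by (induction I rule: infinite_finite_induct) (use grp in auto)
  \<comment> \<open>Candidate bases, with the vectors as columns so that \<open>A y\<close> is the combination with coefficients \<open>y\<close>.\<close>
  let ?basis = "\<lambda>A :: real^'n^'n. (\<forall>j. column j A \<in> L) \<and> det A \<noteq> 0"
  have "column j (matrix ((*\<^sub>R) (real d)) :: real^'n^'n) = real d *\<^sub>R axis j 1" for j
    by (simp add: column_def matrix_def vec_eq_iff)
  then have "?basis (matrix ((*\<^sub>R) (real d)))"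
    using assms(1,2) by simp
  then obtain A where A: "?basis A" and least: "\<And>A'. ?basis A' \<Longrightarrow> nat \<lfloor>\<bar>det A\<bar>\<rfloor> \<le> nat \<lfloor>\<bar>det A'\<bar>\<rfloor>"
    using ex_has_least_nat[of ?basis _ "\<lambda>A. nat \<lfloor>\<bar>det A\<bar>\<rfloor>"] by blast
  have entry: "A $ i $ j \<in> \<int>" for i j
    using A int[of "column j A" i] by (simp add: column_def)
  have in_L: "A *v y \<in> L" if "\<And>i. y $ i \<in> \<int>" for y
    unfolding matrix_mult_sum scalar_mult_eq_scaleR using A that by (intro sum int_mult) auto
  have "y $ k \<in> \<int>" if y: "A *v y \<in> L" for y k
  proof (rule ccontr)
    assume k: "y $ k \<notin> \<int>"
    let ?f = "\<chi> i. frac (y $ i)"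
    have "?f = y - (\<chi> i. of_int \<lfloor>y $ i\<rfloor>)"
      by (simp add: vec_eq_iff frac_def)
    then have "A *v ?f = A *v y + - (A *v (\<chi> i. of_int \<lfloor>y $ i\<rfloor>))"
      by (simp add: matrix_vector_mult_diff_distrib)
    also have "\<dots> \<in> L"
      by (intro grp y in_L) simp
    finally have f: "A *v ?f \<in> L" .
    \<comment> \<open>The exchanged matrix: its determinant is \<open>frac (y\<^sub>k)\<close> times that of \<open>A\<close>.\<close>
    define A' where "A' = (\<chi> i j. if j = k then (A *v ?f) $ i else A $ i $ j)"
    have det: "det A' = frac (y $ k) * det A"
      unfolding A'_def using cramer_lemma[of k A ?f] by simp
    have frac: "0 < frac (y $ k)" "frac (y $ k) < 1"
      using k by (simp_all add: frac_gt_0_iff frac_lt_1)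
    have "column j A' \<in> L" for j
    proof (cases "j = k")
      case True
      then have "column j A' = A *v ?f" by (simp add: column_def A'_def vec_eq_iff)
      then show ?thesis using f by simp
    next
      case False
      then have "column j A' = column j A" by (simp add: column_def A'_def)
      then show ?thesis using A by simp
    qed
    then have A': "?basis A'"
      using det frac A by auto
    have "A' $ i $ j \<in> \<int>" for i j
      using A' int[of "column j A'" i] by (simp add: column_def)
    then have "det A' \<in> \<int>" "det A \<in> \<int>"
      using entry by (auto intro: det_Ints)
    moreover have "\<bar>det A'\<bar> < \<bar>det A\<bar>"
      using det frac A by (simp add: abs_mult)
    ultimately have "nat \<lfloor>\<bar>det A'\<bar>\<rfloor> < nat \<lfloor>\<bar>det A\<bar>\<rfloor>"
      by (auto elim!: Ints_cases simp flip: of_int_abs)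
    then show False using least[OF A'] by linarith
  qed
  moreover define M where "M = (\<chi> i j. \<lfloor>A $ i $ j\<rfloor>)"
  have "map_matrix real_of_int M = A"
    using entry by (simp add: M_def map_matrix_def vec_eq_iff)
  ultimately show ?thesis
    using that[of M] in_L A by (auto simp: invertible_det_nz)
qed

text \<open>
  A rational relation \<open>q\<close> for \<open>\<omega>\<close> gives the relation \<open>p = M\<^sup>-\<^sup>T q\<close> for \<open>M \<omega>\<close>, which is rational by Cramer's
  rule and vanishes only if \<open>q\<close> does.
\<close>

lemma rationally_independent_matrix_preimage:
  fixes M :: "int^'n^'n"
  assumes "rationally_independent (map_matrix real_of_int M *v \<omega>)" "invertible (map_matrix real_of_int M)"
  shows "rationally_independent \<omega>"
  unfolding rationally_independent_def
proof (intro allI impI)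
  fix q :: "'n \<Rightarrow> rat" and i
  assume q: "(\<Sum>i\<in>UNIV. of_rat (q i) * \<omega> $ i) = 0"
  let ?M = "map_matrix real_of_int M" and ?q = "(\<chi> i. of_rat (q i)) :: real^'n"
  let ?A = "transpose ?M"
  have det: "det ?A \<noteq> 0"
    using assms(2) by (simp add: invertible_det_nz det_transpose)
  define p where "p = (\<chi> k. det (\<chi> i j. if j = k then ?q $ i else ?A $ i $ j) / det ?A)"
  have p: "?A *v p = ?q"
    using cramer[OF det, of p ?q] by (simp add: p_def)
  have "det ?A \<in> \<rat>"
    by (rule det_Rats) (simp add: transpose_def map_matrix_def)
  moreover have "det (\<chi> i j. if j = k then ?q $ i else ?A $ i $ j) \<in> \<rat>" for k
    by (rule det_Rats) (simp add: transpose_def map_matrix_def)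
  ultimately have "p $ k \<in> \<rat>" for k
    unfolding p_def vec_lambda_beta by (intro Rats_divide)
  then have "\<forall>k. \<exists>r. p $ k = of_rat r"
    by (metis Rats_cases)
  then obtain r where r: "\<And>k. p $ k = of_rat (r k)" by metis
  have "(\<Sum>i\<in>UNIV. of_rat (r i) * (?M *v \<omega>) $ i) = p \<bullet> (?M *v \<omega>)"
    by (simp add: inner_vec_def r)
  also have "\<dots> = (?A *v p) \<bullet> \<omega>"
    by (simp add: dot_lmul_matrix)
  also have "\<dots> = 0"
    unfolding p using q by (simp add: inner_vec_def)
  finally have "r i = 0" for i
    using assms(1) unfolding rationally_independent_def by blast
  then have "p = 0" by (simp add: vec_eq_iff r)
  then have "?q = 0" using p by simp
  then show "q i = 0" by (simp add: vec_eq_iff)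
qed

section \<open>Critical values and dense orbits\<close>

text \<open>
  A copy of a finite index type, enumerated arbitrarily. Its only use is to give the coordinates of
  \<open>\<real>\<^sup>n\<close> an order, as \<open>baby_Sard\<close> demands of its index types.
\<close>

typedef 'n ordered_copy = "UNIV :: 'n set"
  by blast

instance ordered_copy :: (finite) finite
proof
  have "range Abs_ordered_copy = (UNIV :: 'a ordered_copy set)"
    by (metis Rep_ordered_copy_inverse surjI)
  then show "finite (UNIV :: 'a ordered_copy set)"
    by (metis finite finite_imageI)
qed

definition ordered_copy_index :: "'n::finite ordered_copy \<Rightarrow> nat" where
  "ordered_copy_index = (SOME f. inj f)"

lemma inj_ordered_copy_index: "inj (ordered_copy_index :: 'n::finite ordered_copy \<Rightarrow> nat)"
proof -
  have "\<exists>f :: 'n ordered_copy \<Rightarrow> nat. inj f"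
    using finite_imp_inj_to_nat_seg[OF finite[of "UNIV :: 'n ordered_copy set"]] by blast
  then show ?thesis
    unfolding ordered_copy_index_def by (rule someI_ex)
qed

instantiation ordered_copy :: (finite) wellorder
begin

definition less_eq_ordered_copy :: "'a ordered_copy \<Rightarrow> 'a ordered_copy \<Rightarrow> bool" where
  "x \<le> y \<longleftrightarrow> ordered_copy_index x \<le> ordered_copy_index y"

definition less_ordered_copy :: "'a ordered_copy \<Rightarrow> 'a ordered_copy \<Rightarrow> bool" where
  "x < y \<longleftrightarrow> ordered_copy_index x < ordered_copy_index y"

instance
proof
  fix P :: "'a ordered_copy \<Rightarrow> bool" and a
  assume step: "\<And>x. (\<And>y. y < x \<Longrightarrow> P y) \<Longrightarrow> P x"
  show "P a"
    by (induction a rule: measure_induct_rule[of ordered_copy_index])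
      (metis less_ordered_copy_def step)
qed (use inj_ordered_copy_index in
    \<open>auto simp: less_eq_ordered_copy_def less_ordered_copy_def dest: injD\<close>)

end

lemma card_ordered_copy: "CARD('n ordered_copy) = CARD('n)"
  by (rule bij_betw_same_card[of Rep_ordered_copy])
    (auto simp: bij_betw_def Rep_ordered_copy_inject inj_def intro: Abs_ordered_copy_inverse[symmetric] rangeI)

text \<open>
  Sard's theorem in equal dimensions. The linear relabelling of coordinates and its inverse preserve
  differentiability, singularity of the derivative and negligibility.
\<close>

lemma negligible_critical_values:
  fixes f :: "real^'n \<Rightarrow> real^'n"
  assumes der: "\<And>x. x \<in> S \<Longrightarrow> (f has_derivative f' x) (at x)"
    and sing: "\<And>x. x \<in> S \<Longrightarrow> \<not> inj (f' x)"
  shows "negligible (f ` S)"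
proof -
  define h :: "real^'n \<Rightarrow> real^'n ordered_copy" where "h x = (\<chi> i. x $ Rep_ordered_copy i)" for x
  define k :: "real^'n ordered_copy \<Rightarrow> real^'n" where "k x = (\<chi> i. x $ Abs_ordered_copy i)" for x
  have kh: "k (h x) = x" for x
    by (simp add: h_def k_def vec_eq_iff Abs_ordered_copy_inverse)
  have lin: "linear h" "linear k"
    by (auto intro!: linearI simp: h_def k_def vec_eq_iff)
  then have bl: "bounded_linear h" "bounded_linear k"
    by (simp_all add: linear_conv_bounded_linear)
  have "negligible ((h \<circ> f \<circ> k) ` h ` S)"
  proof (rule baby_Sard[where f' = "\<lambda>y. h \<circ> f' (k y) \<circ> k"])
    fix y assume "y \<in> h ` S"
    then have y: "k y \<in> S" by (auto simp: kh)
    have f: "(f has_derivative f' (k y)) (at (k y))"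
      using der[OF y] .
    have "(f \<circ> k has_derivative f' (k y) \<circ> k) (at y)"
      by (rule diff_chain_at[OF bounded_linear_imp_has_derivative[OF bl(2)] f])
    from diff_chain_at[OF this bounded_linear_imp_has_derivative[OF bl(1)]]
    have D: "((h \<circ> f \<circ> k) has_derivative (h \<circ> f' (k y) \<circ> k)) (at y)"
      by (simp add: comp_assoc)
    then show "((h \<circ> f \<circ> k) has_derivative (h \<circ> f' (k y) \<circ> k)) (at y within h ` S)"
      by (rule has_derivative_at_withinI)
    obtain u v where "u \<noteq> v" "f' (k y) u = f' (k y) v"
      using sing[OF y] by (auto simp: inj_def)
    then have "h u \<noteq> h v" "(h \<circ> f' (k y) \<circ> k) (h u) = (h \<circ> f' (k y) \<circ> k) (h v)"
      using kh by (metis, simp)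
    then have "\<not> inj (h \<circ> f' (k y) \<circ> k)"
      by (meson injD)
    then show "rank (matrix (h \<circ> f' (k y) \<circ> k)) < CARD('n ordered_copy)"
      using has_derivative_linear[OF D] by (simp add: less_rank_noninjective)
  qed simp
  then have "negligible (k ` (h \<circ> f \<circ> k) ` h ` S)"
    by (rule negligible_differentiable_image_negligible[rotated])
      (auto intro!: linear_imp_differentiable_on lin simp: card_ordered_copy)
  moreover have "k ` (h \<circ> f \<circ> k) ` h ` S = f ` S"
    by (simp add: image_image kh)
  ultimately show ?thesis by simp
qed

text \<open>
  Kronecker's simultaneous approximation theorem, transported from indices \<open>0, \<dots>, n - 1\<close> to the index
  type: the orbit of \<open>0\<close> under the linear flow is dense modulo \<open>\<int>\<^sup>n\<close>.
\<close>

lemma rationally_independent_flow_dense: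
  fixes \<omega> \<alpha> :: "real^'n"
  assumes ind: "rationally_independent \<omega>" and "\<epsilon> > 0"
  obtains t z where "\<And>i. z $ i \<in> \<int>" "norm (t *\<^sub>R \<omega> - z - \<alpha>) < \<epsilon>"
proof -
  interpret int: Modules.module "\<lambda>r. (*) (real_of_int r)"
    by (simp add: Modules.module.intro distrib_left mult.commute)
  obtain e where e: "bij_betw e {..<CARD('n)} (UNIV :: 'n set)"
    using ex_bij_betw_nat_finite[of "UNIV :: 'n set"] by (auto simp: atLeast0LessThan)
  define \<theta> where "\<theta> k = \<omega> $ e k" for k
  have "inj (($) \<omega>)"
  proof (rule injI, rule ccontr)
    fix i j assume eq: "\<omega> $ i = \<omega> $ j" and "i \<noteq> j"
    \<comment> \<open>Equal components would satisfy the relation \<open>\<omega>\<^sub>i - \<omega>\<^sub>j = 0\<close>.\<close>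
    define q :: "'n \<Rightarrow> rat" where "q k = (if k = i then 1 else if k = j then - 1 else 0)" for k
    have "(\<Sum>k\<in>UNIV. of_rat (q k) * \<omega> $ k) = (\<Sum>k\<in>{i, j}. of_rat (q k) * \<omega> $ k)"
      by (rule sum.mono_neutral_right) (auto simp: q_def)
    then have "(\<Sum>k\<in>UNIV. of_rat (q k) * \<omega> $ k) = 0"
      using eq \<open>i \<noteq> j\<close> by (simp add: q_def of_rat_minus)
    then have "q i = 0"
      using ind unfolding rationally_independent_def by blast
    then show False by (simp add: q_def)
  qed
  then have inj: "inj_on \<theta> {..<CARD('n)}"
    using e unfolding \<theta>_def by (auto simp: inj_on_def bij_betw_def)
  have "c x = 0" if sum: "(\<Sum>x\<in>\<theta> ` {..<CARD('n)}. real_of_int (c x) * x) = 0"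
    and x: "x \<in> \<theta> ` {..<CARD('n)}" for c x
  proof -
    have "(\<Sum>i\<in>UNIV. of_rat (of_int (c (\<omega> $ i))) * \<omega> $ i) = (\<Sum>k<CARD('n). real_of_int (c (\<theta> k)) * \<theta> k)"
      unfolding \<theta>_def by (simp add: sum.reindex_bij_betw[OF e, symmetric])
    also have "\<dots> = 0"
      using sum by (simp add: sum.reindex[OF inj])
    finally have "of_int (c (\<omega> $ i)) = (0 :: rat)" for i
      using ind[unfolded rationally_independent_def, rule_format, of "\<lambda>i. of_int (c (\<omega> $ i))"] by blast
    then show ?thesis
      using x by (auto simp: \<theta>_def)
  qed
  then have "int.independent (\<theta> ` {..<CARD('n)})"
    by (auto simp: int.dependent_finite)
  then obtain t h where th: "\<And>k. k < CARD('n) \<Longrightarrow> \<bar>t * \<theta> k - of_int (h k) - \<alpha> $ e k\<bar> < \<epsilon> / CARD('n)"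
    using Kronecker_thm_1[of \<theta> "CARD('n)" "\<epsilon> / CARD('n)" "\<lambda>k. \<alpha> $ e k"] inj \<open>\<epsilon> > 0\<close> by auto
  define z where "z = (\<chi> i. real_of_int (h (the_inv_into {..<CARD('n)} e i)))"
  have comp: "\<bar>(t *\<^sub>R \<omega> - z - \<alpha>) $ i\<bar> < \<epsilon> / CARD('n)" for i
  proof -
    obtain k where "k < CARD('n)" "i = e k"
      using e by (metis UNIV_I bij_betw_def imageE lessThan_iff)
    then show ?thesis
      using th[of k] e by (simp add: z_def \<theta>_def bij_betw_def the_inv_into_f_f)
  qed
  have "norm (t *\<^sub>R \<omega> - z - \<alpha>) \<le> (\<Sum>i\<in>UNIV. \<bar>(t *\<^sub>R \<omega> - z - \<alpha>) $ i\<bar>)"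
    by (rule norm_le_l1_cart)
  also have "\<dots> < (\<Sum>i\<in>(UNIV :: 'n set). \<epsilon> / CARD('n))"
    by (rule sum_strict_mono) (use comp in auto)
  finally have "norm (t *\<^sub>R \<omega> - z - \<alpha>) < \<epsilon>" by simp
  then show ?thesis
    using that[of z t] by (simp add: z_def)
qed

section \<open>Maps into the torus in local coordinates\<close>

text \<open>
  The difference of the two lifts is continuous and, up to a constant, integer-valued, hence locally
  constant. The translation \<open>\<tau>\<close> allows the lifts of \<open>F\<close> before and after flowing to be compared.
\<close>

lemma lifts_differ_by_constant:
  fixes f g :: "'e::topological_space \<Rightarrow> real^'n"
  assumes "open S" "z\<^sub>0 \<in> S" "continuous_on S f" "continuous_on S g"
    and eq: "\<And>z. z \<in> S \<Longrightarrow> mod1 (f z) = \<tau> + mod1 (g z)"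
  shows "\<exists>T. open T \<and> z\<^sub>0 \<in> T \<and> T \<subseteq> S \<and> (\<forall>z\<in>T. f z = g z + (f z\<^sub>0 - g z\<^sub>0))"
proof -
  obtain c where c: "\<tau> = mod1 c" by (metis surj_mod1)
  define h where "h z = (f z - g z) - (f z\<^sub>0 - g z\<^sub>0)" for z
  have "continuous_on S h"
    unfolding h_def by (intro continuous_intros assms)
  then have op: "open (h -` ball 0 1 \<inter> S)"
    using assms(1) by (simp add: continuous_on_open_vimage)
  have const: "f z = g z + (f z\<^sub>0 - g z\<^sub>0)" if "z \<in> h -` ball 0 1 \<inter> S" for z
  proof -
    have lift: "(f y - (c + g y)) $ i \<in> \<int>" if "y \<in> S" for y i
      using eq[OF that] by (simp add: c mod1_eq_iff flip: mod1_add)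
    have "(f z - (c + g z)) $ i - (f z\<^sub>0 - (c + g z\<^sub>0)) $ i \<in> \<int>" for i
      using lift[of z i] lift[OF assms(2), of i] that by (intro Ints_diff) simp_all
    then have "h z $ i \<in> \<int>" for i
      by (simp add: h_def algebra_simps)
    then have "h z = 0"
      using norm_int_vec_ge_1[of "h z"] that by fastforce
    then show ?thesis by (simp add: h_def algebra_simps)
  qed
  have "z\<^sub>0 \<in> h -` ball 0 1 \<inter> S"
    using assms(2) by (simp add: h_def)
  then show ?thesis
    by (intro exI[of _ "h -` ball 0 1 \<inter> S"] conjI ballI op const) (assumption | rule Int_lower2)+
qed

text \<open>
  Smoothness of a map into the torus is handled through its real vector-valued lifts, which avoids
  choosing charts of the torus.
\<close>

definition local_lift :: "('e::topological_space \<Rightarrow> 'n::finite torus) \<Rightarrow> 'e set \<Rightarrow> ('e \<Rightarrow> real^'n) \<Rightarrow> bool" where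
  "local_lift g S f \<longleftrightarrow> open S \<and> continuous_on S f \<and> (\<forall>z\<in>S. mod1 (f z) = g z)"

lemma is_chartD:
  assumes "is_chart (U, \<phi>)"
  shows "open U" "open (\<phi> ` U)" "inj_on \<phi> U" "continuous_on U \<phi>"
    "continuous_on (\<phi> ` U) (the_inv_into U \<phi>)"
    "\<And>x. x \<in> U \<Longrightarrow> the_inv_into U \<phi> (\<phi> x) = x"
    "\<And>z. z \<in> \<phi> ` U \<Longrightarrow> \<phi> (the_inv_into U \<phi> z) = z"
    "\<And>z. z \<in> \<phi> ` U \<Longrightarrow> the_inv_into U \<phi> z \<in> U"
    "\<And>W. open W \<Longrightarrow> open (U \<inter> \<phi> -` W)"
    "\<And>W. open W \<Longrightarrow> open (\<phi> ` (U \<inter> W))"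
proof -
  from assms have hom: "homeomorphism U (\<phi> ` U) \<phi> (the_inv_into U \<phi>)"
    and op: "open U" "open (\<phi> ` U)"
    by (auto simp: is_chart_def)
  show "open U" "open (\<phi> ` U)" by fact+
  show "continuous_on U \<phi>" "continuous_on (\<phi> ` U) (the_inv_into U \<phi>)"
    using hom by (auto simp: homeomorphism_def)
  show inv: "the_inv_into U \<phi> (\<phi> x) = x" if "x \<in> U" for x
    using hom that by (auto simp: homeomorphism_def)
  then show "inj_on \<phi> U" by (metis inj_onI)
  show "\<phi> (the_inv_into U \<phi> z) = z" "the_inv_into U \<phi> z \<in> U" if "z \<in> \<phi> ` U" for z
    using that inv by auto
  show "open (U \<inter> \<phi> -` W)" if "open W" for W
    using \<open>continuous_on U \<phi>\<close> op(1) that by (simp add: continuous_on_open_vimage Int_commute)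
  have "\<phi> ` (U \<inter> W) = the_inv_into U \<phi> -` W \<inter> \<phi> ` U" for W
    using inv by auto
  then show "open (\<phi> ` (U \<inter> W))" if "open W" for W
    using \<open>continuous_on (\<phi> ` U) (the_inv_into U \<phi>)\<close> op(2) that by (simp add: continuous_on_open_vimage)
qed

lemma Ck_map_torus_local_lift:
  assumes G: "Ck_map k A torus_atlas G" and A: "(U, \<phi>) \<in> A" "is_chart (U, \<phi>)" and "p \<in> U"
  obtains S f where "\<phi> p \<in> S" "S \<subseteq> \<phi> ` U" "local_lift (G \<circ> the_inv_into U \<phi>) S f" "Ck_on k S f"
proof -
  note chart = is_chartD[OF A(2)]
  obtain y where y: "G p = mod1 y" by (metis surj_mod1)
  let ?V = "ball y (1/2)"
  let ?s = "the_inv_into ?V mod1"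
  let ?S = "\<phi> ` (U \<inter> G -` mod1 ` ?V)"
  have "(mod1 ` ?V, ?s) \<in> torus_atlas"
    using inj_on_mod1_ball by (auto simp: torus_atlas_def)
  then have Ck: "Ck_on k ?S (?s \<circ> G \<circ> the_inv_into U \<phi>)"
    using G A(1) unfolding Ck_map_def by fast
  have "continuous_on UNIV G"
    using G by (simp add: Ck_map_def)
  then have "open (G -` mod1 ` ?V)"
    by (intro open_vimage open_mod1_image open_ball)
  then have "open ?S" by (rule chart(10))
  moreover have "continuous_on ?S (?s \<circ> G \<circ> the_inv_into U \<phi>)"
    using Ck unfolding Ck_on_def by (metis cont_diff_on.simps(1) zero_enat_def zero_le)
  moreover have "mod1 ((?s \<circ> G \<circ> the_inv_into U \<phi>) z) = G (the_inv_into U \<phi> z)" if "z \<in> ?S" for z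
    using that chart(6) f_the_inv_into_f[OF inj_on_mod1_ball[of y]] by auto
  ultimately have "local_lift (G \<circ> the_inv_into U \<phi>) ?S (?s \<circ> G \<circ> the_inv_into U \<phi>)"
    by (simp add: local_lift_def)
  moreover have "\<phi> p \<in> ?S"
    using \<open>p \<in> U\<close> y by (intro imageI) auto
  moreover have "?S \<subseteq> \<phi> ` U"
    by blast
  ultimately show ?thesis
    using Ck by (intro that)
qed

lemma Ck_on_local:
  assumes "\<And>z. z \<in> S \<Longrightarrow> \<exists>T f'. open T \<and> z \<in> T \<and> Ck_on k T f' \<and> (\<forall>w\<in>T. f w = f' w)"
  shows "Ck_on k S f"
  unfolding Ck_on_def
proof (intro allI impI cont_diff_on_local)
  fix m z assume m: "enat m \<le> k" and "z \<in> S"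
  then obtain T f' where T: "open T" "z \<in> T" "Ck_on k T f'" "\<forall>w\<in>T. f w = f' w"
    using assms[OF \<open>z \<in> S\<close>] by blast
  have "cont_diff_on m T f"
    by (rule cont_diff_on_cong[of T f']) (use T m in \<open>auto simp: Ck_on_def\<close>)
  then have "cont_diff_on m (S \<inter> T) f"
    by (rule cont_diff_on_subset) simp
  then show "\<exists>T. open T \<and> z \<in> T \<and> cont_diff_on m (S \<inter> T) f"
    using T(1,2) by blast
qed

lemma Ck_on_subset: "Ck_on k S f \<Longrightarrow> T \<subseteq> S \<Longrightarrow> Ck_on k T f"
  unfolding Ck_on_def using cont_diff_on_subset by blast

lemma Ck_on_imp_continuous_on: "Ck_on k S f \<Longrightarrow> continuous_on S f"
  unfolding Ck_on_def by (metis cont_diff_on.simps(1) zero_enat_def zero_le)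

lemma isCont_via_chart:
  fixes G :: "'a::t2_space \<Rightarrow> 'b::topological_space" and \<phi> :: "'a \<Rightarrow> 'e::euclidean_space"
  assumes "is_chart (U, \<phi>)" "p \<in> U" "open S" "\<phi> p \<in> S" "continuous_on S g"
    and eq: "\<And>x. x \<in> U \<Longrightarrow> \<phi> x \<in> S \<Longrightarrow> G x = g (\<phi> x)"
  shows "isCont G p"
proof -
  note chart = is_chartD[OF assms(1)]
  let ?O = "U \<inter> \<phi> -` S"
  have "continuous_on ?O (\<lambda>x. g (\<phi> x))"
    by (rule continuous_on_compose2[OF assms(5) continuous_on_subset[OF chart(4)]]) auto
  then have "continuous_on ?O G"
    by (rule continuous_on_eq) (use eq in auto)
  then show ?thesis
    using chart(9)[OF assms(3)] assms(2,4) by (simp add: continuous_on_eq_continuous_at)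
qed

lemma Ck_atlas_chart_at:
  assumes "Ck_atlas k A"
  obtains U \<phi> where "(U, \<phi>) \<in> A" "p \<in> U" "is_chart (U, \<phi>)"
proof -
  have "p \<in> (\<Union>(U, \<phi>)\<in>A. U)"
    using assms by (simp add: Ck_atlas_def)
  then show ?thesis
    using that assms by (auto simp: Ck_atlas_def)
qed

text \<open>
  In any chart of the torus the map equals its lift up to an integer vector, which is locally
  constant.
\<close>

lemma Ck_map_torusI:
  fixes A :: "('a::t2_space, 'e::euclidean_space) chart set"
  assumes A: "Ck_atlas k A"
    and lift: "\<And>U \<phi> p. (U, \<phi>) \<in> A \<Longrightarrow> p \<in> U \<Longrightarrow>
      \<exists>S f. \<phi> p \<in> S \<and> S \<subseteq> \<phi> ` U \<and> local_lift (G \<circ> the_inv_into U \<phi>) S f \<and> Ck_on k S f"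
  shows "Ck_map k A torus_atlas G"
  unfolding Ck_map_def
proof (intro conjI ballI, safe)
  have chart: "is_chart (U, \<phi>)" if "(U, \<phi>) \<in> A" for U \<phi>
    using A that by (auto simp: Ck_atlas_def)
  have "isCont G p" for p
  proof -
    obtain U \<phi> where U: "(U, \<phi>) \<in> A" "p \<in> U"
      using Ck_atlas_chart_at[OF A] by blast
    obtain S f where S: "\<phi> p \<in> S" "S \<subseteq> \<phi> ` U" "local_lift (G \<circ> the_inv_into U \<phi>) S f"
      using lift[OF U] by blast
    show ?thesis
    proof (rule isCont_via_chart[OF chart[OF U(1)] U(2) _ S(1)])
      show "open S" using S(3) by (simp add: local_lift_def)
      show "continuous_on S (mod1 \<circ> f)"
        using S(3) by (intro continuous_on_compose continuous_on_mod1) (simp add: local_lift_def)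
      show "G x = (mod1 \<circ> f) (\<phi> x)" if "x \<in> U" "\<phi> x \<in> S" for x
        using S(3) is_chartD(6)[OF chart[OF U(1)] that(1)] that(2) by (simp add: local_lift_def)
    qed
  qed
  then show "continuous_on UNIV G"
    by (simp add: continuous_at_imp_continuous_on)
  fix U \<phi> and Q :: "'b torus set" and s
  assume U: "(U, \<phi>) \<in> A" and "(Q, s) \<in> torus_atlas"
  then obtain V where V: "Q = mod1 ` V" "s = the_inv_into V mod1" "open V" "inj_on mod1 V"
    by (auto simp: torus_atlas_def)
  note ch = is_chartD[OF chart[OF U]]
  show "Ck_on k (\<phi> ` (U \<inter> G -` Q)) (s \<circ> G \<circ> the_inv_into U \<phi>)"
  proof (rule Ck_on_local)
    fix z assume "z \<in> \<phi> ` (U \<inter> G -` Q)"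
    then obtain p y where p: "z = \<phi> p" "p \<in> U" and y: "G p = mod1 y" "y \<in> V"
      unfolding V by auto
    obtain S f where S: "z \<in> S" "S \<subseteq> \<phi> ` U" "local_lift (G \<circ> the_inv_into U \<phi>) S f" "Ck_on k S f"
      using lift[OF U p(2)] unfolding p(1) by blast
    note l = S(3)[unfolded local_lift_def]
    let ?f = "\<lambda>w. f w + (y - f z)"
    let ?T = "?f -` V \<inter> S"
    have "continuous_on S ?f"
      using l by (intro continuous_intros) auto
    then have "open ?T"
      using l V(3) by (simp add: continuous_on_open_vimage)
    moreover have "z \<in> ?T"
      using S(1) y(2) by simp
    moreover have "Ck_on k ?T ?f"
      unfolding Ck_on_def
    proof (intro allI impI cont_diff_on_add cont_diff_on_const)
      show "cont_diff_on m ?T f" if "enat m \<le> k" for m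
        using S(4) that cont_diff_on_subset[of m S f ?T] by (auto simp: Ck_on_def)
    qed (use \<open>open ?T\<close> in simp)
    moreover have "(s \<circ> G \<circ> the_inv_into U \<phi>) w = ?f w" if "w \<in> ?T" for w
    proof -
      have "mod1 y = mod1 (f z)"
        using l S(1) y(1) p ch(6) by simp
      then have "mod1 (?f w) = mod1 (f w)"
        by (auto simp: mod1_eq_iff)
      also have "\<dots> = G (the_inv_into U \<phi> w)"
        using l that by simp
      finally show ?thesis
        using that V the_inv_into_f_f[OF V(4), of "?f w"] by simp
    qed
    ultimately show "\<exists>T f'. open T \<and> z \<in> T \<and> Ck_on k T f' \<and> (\<forall>w\<in>T. (s \<circ> G \<circ> the_inv_into U \<phi>) w = f' w)"
      by blast
  qed
qed

section \<open>The semi-conjugacy is a local diffeomorphism\<close>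

lemma countable_integer_vectors: "countable {l :: real^'n. \<forall>i. l $ i \<in> \<int>}"
proof -
  have "countable (\<int> :: real set)"
    unfolding Ints_def by simp
  then show ?thesis
    by (rule countable_vector)
qed

text \<open>
  The standing hypotheses: a \<open>C\<^sup>k\<close> flow on a closed connected \<open>n\<close>-manifold and a semi-conjugacy to a
  rationally independent linear flow on the \<open>n\<close>-torus.
\<close>

locale flow_over_torus =
  fixes k :: enat
    and A :: "('a::{t2_space, second_countable_topology}, real^'n) chart set"
    and \<Phi> :: "real \<Rightarrow> 'a \<Rightarrow> 'a"
    and F :: "'a \<Rightarrow> 'n torus"
    and \<omega> :: "real^'n"
  assumes k: "1 \<le> k"
    and manifold: "Ck_manifold k A"
    and compact: "compact (UNIV :: 'a set)"
    and connected: "connected (UNIV :: 'a set)"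
    and flow: "Ck_flow k A \<Phi>"
    and F: "Ck_map k A torus_atlas F"
    and independent: "rationally_independent \<omega>"
    and F_flow: "F (\<Phi> t x) = mod1 (t *\<^sub>R \<omega>) + F x"
begin

lemma atlas: "Ck_atlas k A"
  using manifold by (simp add: Ck_manifold_def)

lemma chart: "(U, \<phi>) \<in> A \<Longrightarrow> is_chart (U, \<phi>)"
  using atlas by (auto simp: Ck_atlas_def)

lemma chart_at:
  obtains U \<phi> where "(U, \<phi>) \<in> A" "p \<in> U" "is_chart (U, \<phi>)"
  using Ck_atlas_chart_at[OF atlas] .

lemma flow_zero: "\<Phi> 0 x = x" and flow_add: "\<Phi> (s + t) x = \<Phi> s (\<Phi> t x)"
  using flow by (auto simp: Ck_flow_def)

lemma continuous_on_flow: "continuous_on UNIV (\<lambda>(t, x). \<Phi> t x)"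
  using flow by (auto simp: Ck_flow_def Ck_map_def)

lemma continuous_on_flow_time: "continuous_on UNIV (\<lambda>t. \<Phi> t x)"
  using continuous_on_compose2[OF continuous_on_flow, of UNIV "\<lambda>t. (t, x)"]
  by (simp add: continuous_on_Pair continuous_on_const continuous_on_id)

lemma continuous_on_flow_space: "continuous_on UNIV (\<Phi> t)"
  using continuous_on_compose2[OF continuous_on_flow, of UNIV "\<lambda>x. (t, x)"]
  by (simp add: continuous_on_Pair continuous_on_const continuous_on_id)

lemma C1:
  assumes "Ck_on k S f"
  shows "cont_diff_on (Suc 0) S f"
  using assms k unfolding Ck_on_def one_enat_def One_nat_def by blast

text \<open>
  The chart expression of the flow in a product chart is smooth jointly in time and space; it is
  restricted to the slice of fixed time.
\<close>

lemma flow_differentiable: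
  assumes U: "(U, \<phi>) \<in> A" "x \<in> U" and V: "(V, \<psi>) \<in> A" "\<Phi> t x \<in> V"
  obtains D where "((\<lambda>z. \<psi> (\<Phi> t (the_inv_into U \<phi> z))) has_derivative D) (at (\<phi> x))"
proof -
  note ch = is_chartD[OF chart[OF U(1)]]
  let ?inv = "the_inv_into (UNIV \<times> U) (map_prod id \<phi>)"
  let ?S = "map_prod id \<phi> ` ((UNIV \<times> U) \<inter> (\<lambda>(t, x). \<Phi> t x) -` V)"
  let ?g = "\<psi> \<circ> (\<lambda>(t, x). \<Phi> t x) \<circ> ?inv"
  have "(UNIV \<times> U, map_prod id \<phi>) \<in> prod_atlas std_atlas A"
    using U(1) by (force simp: prod_atlas_def std_atlas_def)
  moreover have "Ck_map k (prod_atlas std_atlas A) A (\<lambda>(t, x). \<Phi> t x)"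
    using flow by (simp add: Ck_flow_def)
  ultimately have "Ck_on k ?S ?g"
    using V(1) unfolding Ck_map_def by fast
  from C1[OF this] have "\<forall>z\<in>?S. ?g differentiable at z"
    unfolding cont_diff_on.simps by (rule conjunct1)
  moreover have "(t, \<phi> x) \<in> ?S"
    using U(2) V(2) by force
  ultimately have "?g differentiable at (t, \<phi> x)"
    by (rule bspec)
  then obtain D where "(?g has_derivative D) (at (t, \<phi> x))"
    unfolding differentiable_def by blast
  moreover have "((\<lambda>z. (t, z)) has_derivative (\<lambda>v. (0, v))) (at (\<phi> x))"
    by (intro has_derivative_Pair has_derivative_const has_derivative_ident)
  ultimately have D: "((\<lambda>z. ?g (t, z)) has_derivative (\<lambda>v. D (0, v))) (at (\<phi> x))"
    using has_derivative_compose by blast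
  have inj: "inj_on (map_prod id \<phi>) (UNIV \<times> U)"
    using ch(3) by (auto simp: inj_on_def)
  have "?inv (t, z) = (t, the_inv_into U \<phi> z)" if "z \<in> \<phi> ` U" for z
    using the_inv_into_f_f[OF inj, of "(t, the_inv_into U \<phi> z)"] ch(7,8)[OF that] by simp
  then have eq: "?g (t, z) = \<psi> (\<Phi> t (the_inv_into U \<phi> z))" if "z \<in> \<phi> ` U" for z
    using that by simp
  show ?thesis
    by (rule that[OF has_derivative_transform_within_open[OF D ch(2) imageI[OF U(2)] eq]])
qed

text \<open>
  That the derivative of \<open>F\<close> at \<open>x\<close> is invertible is asked for one chart and one lift only; this
  does not depend on the choices by \<open>regular_derivative\<close> below.
\<close>

definition regular :: "'a \<Rightarrow> bool" where
  "regular x \<longleftrightarrow> (\<exists>U \<phi> S f D. (U, \<phi>) \<in> A \<and> x \<in> U \<and> \<phi> x \<in> S \<and>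
     local_lift (F \<circ> the_inv_into U \<phi>) S f \<and> (f has_derivative D) (at (\<phi> x)) \<and> inj D)"

text \<open>
  Differentiating \<open>F \<circ> \<Phi>\<^sup>t = F + t \<omega>\<close> gives \<open>D' \<circ> D\<Phi>\<^sup>t = D\<close>. If the square matrix \<open>D\<close> is injective,
  so is \<open>D\<Phi>\<^sup>t\<close>, which is then bijective, and therefore \<open>D'\<close> is injective as well. The target chart
  and lift being arbitrary, time \<open>0\<close> yields independence of charts.
\<close>

lemma regular_flow_derivative:
  assumes "regular x" and V: "(V, \<psi>) \<in> A" "\<Phi> t x \<in> V" "\<psi> (\<Phi> t x) \<in> S'"
    and f': "local_lift (F \<circ> the_inv_into V \<psi>) S' f'" "(f' has_derivative D') (at (\<psi> (\<Phi> t x)))"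
  shows "inj D'"
proof -
  obtain U \<phi> S f D where U: "(U, \<phi>) \<in> A" "x \<in> U" "\<phi> x \<in> S"
    and f: "local_lift (F \<circ> the_inv_into U \<phi>) S f" "(f has_derivative D) (at (\<phi> x))" "inj D"
    using assms(1) unfolding regular_def by blast
  note chU = is_chartD[OF chart[OF U(1)]] and chV = is_chartD[OF chart[OF V(1)]]
  define H where "H z = \<psi> (\<Phi> t (the_inv_into U \<phi> z))" for z
  define W where "W = \<phi> ` (U \<inter> \<Phi> t -` V)"
  have "open (\<Phi> t -` V)"
    using continuous_on_flow_space chV(1) by (simp add: open_vimage)
  then have W: "open W" "\<phi> x \<in> W" "W \<subseteq> \<phi> ` U"
    using chU(10) U(2) V(2) by (auto simp: W_def)
  have WV: "\<Phi> t (the_inv_into U \<phi> z) \<in> V" if "z \<in> W" for z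
    using that chU(6) by (auto simp: W_def)
  have "continuous_on W (\<lambda>z. \<Phi> t (the_inv_into U \<phi> z))"
    by (rule continuous_on_compose2[OF continuous_on_flow_space continuous_on_subset[OF chU(5) W(3)]]) simp
  then have contH: "continuous_on W H"
    unfolding H_def by (rule continuous_on_compose2[OF chV(4)]) (use WV in auto)
  \<comment> \<open>On \<open>T\<close> both \<open>f' \<circ> H\<close> and \<open>f\<close> are defined, and they lift \<open>F \<circ> \<Phi>\<^sup>t\<close> and \<open>F\<close>.\<close>
  define T where "T = S \<inter> (H -` S' \<inter> W)"
  have "open T"
    using f(1) f'(1) W(1) contH unfolding T_def local_lift_def
    by (intro open_Int[of S]) (simp_all add: continuous_on_open_vimage)
  moreover have "\<phi> x \<in> T"
    using U W V(3) chU(6) by (simp add: T_def H_def)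
  moreover have "continuous_on T (\<lambda>z. f' (H z))"
  proof (rule continuous_on_compose2[of S' f'])
    show "continuous_on T H"
      by (rule continuous_on_subset[OF contH]) (auto simp: T_def)
  qed (use f'(1) in \<open>auto simp: T_def local_lift_def\<close>)
  moreover have "continuous_on T f"
    using f(1) continuous_on_subset[of S f T] by (auto simp: T_def local_lift_def)
  moreover have "mod1 (f' (H z)) = mod1 (t *\<^sub>R \<omega>) + mod1 (f z)" if "z \<in> T" for z
  proof -
    have z: "z \<in> S" "H z \<in> S'" "z \<in> W" using that by (auto simp: T_def)
    have "mod1 (f' (H z)) = F (the_inv_into V \<psi> (H z))"
      using f'(1) z by (simp add: local_lift_def)
    also have "the_inv_into V \<psi> (H z) = \<Phi> t (the_inv_into U \<phi> z)"
      using chV(6) WV z by (simp add: H_def)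
    finally show ?thesis
      using f(1) z by (simp add: F_flow local_lift_def)
  qed
  ultimately have "\<exists>T'. open T' \<and> \<phi> x \<in> T' \<and> T' \<subseteq> T \<and>
      (\<forall>z\<in>T'. f' (H z) = f z + (f' (H (\<phi> x)) - f (\<phi> x)))"
    by (rule lifts_differ_by_constant)
  then obtain T' where T': "open T'" "\<phi> x \<in> T'" "T' \<subseteq> T"
    "\<And>z. z \<in> T' \<Longrightarrow> f' (H z) = f z + (f' (H (\<phi> x)) - f (\<phi> x))"
    by (elim exE conjE) (metis (no_types))
  obtain DH where DH: "(H has_derivative DH) (at (\<phi> x))"
    using flow_differentiable[OF U(1,2) V(1,2)] unfolding H_def by blast
  have "(f' has_derivative D') (at (H (\<phi> x)))"
    using f'(2) chU(6)[OF U(2)] by (simp add: H_def)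
  then have 1: "((\<lambda>z. f' (H z)) has_derivative (\<lambda>v. D' (DH v))) (at (\<phi> x))"
    by (rule has_derivative_compose[OF DH])
  have "((\<lambda>z. f z + (f' (H (\<phi> x)) - f (\<phi> x))) has_derivative D) (at (\<phi> x))"
    using has_derivative_add[OF f(2) has_derivative_const] by simp
  then have "((\<lambda>z. f' (H z)) has_derivative D) (at (\<phi> x))"
    by (rule has_derivative_transform_within_open[OF _ T'(1,2)]) (use T'(4) in simp)
  with 1 have D: "D = (\<lambda>v. D' (DH v))"
    using has_derivative_unique by blast
  then have "inj DH"
    using f(3) by (metis (mono_tags, lifting) injD injI)
  then have "surj DH"
    using has_derivative_linear[OF DH] linear_injective_imp_surjective by blast
  show ?thesis
  proof (rule injI)
    fix a b assume eq: "D' a = D' b"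
    obtain u v where uv: "a = DH u" "b = DH v"
      using \<open>surj DH\<close> by (metis surjD)
    then have "D u = D v" using eq D by simp
    then show "a = b" using f(3) uv by (simp add: inj_eq)
  qed
qed

lemma regular_derivative:
  assumes "regular x" and "(V, \<psi>) \<in> A" "x \<in> V" "\<psi> x \<in> S'"
    and "local_lift (F \<circ> the_inv_into V \<psi>) S' f'" "(f' has_derivative D') (at (\<psi> x))"
  shows "inj D'"
  using regular_flow_derivative[of x V \<psi> 0] assms by (simp add: flow_zero)

lemma lift_at:
  assumes "(U, \<phi>) \<in> A" "p \<in> U"
  obtains S f where "\<phi> p \<in> S" "S \<subseteq> \<phi> ` U" "local_lift (F \<circ> the_inv_into U \<phi>) S f" "Ck_on k S f"
  using Ck_map_torus_local_lift[OF F assms(1) chart[OF assms(1)] assms(2)] .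

lemma lift_has_derivative:
  assumes "Ck_on k S f" "z \<in> S"
  shows "(f has_derivative frechet_derivative f (at z)) (at z)"
  using cont_diff_on_has_derivative[OF C1] assms by blast

lemma regular_flow:
  assumes "regular x"
  shows "regular (\<Phi> t x)"
proof -
  obtain V \<psi> where V: "(V, \<psi>) \<in> A" "\<Phi> t x \<in> V" "is_chart (V, \<psi>)"
    using chart_at by blast
  obtain S f where S: "\<psi> (\<Phi> t x) \<in> S" "S \<subseteq> \<psi> ` V" "local_lift (F \<circ> the_inv_into V \<psi>) S f" "Ck_on k S f"
    using lift_at[OF V(1,2)] .
  note D = lift_has_derivative[OF S(4,1)]
  show ?thesis
    unfolding regular_def
    using V(1,2) S(1,3) D regular_flow_derivative[OF assms V(1,2) S(1,3) D]
    by (intro exI[of _ V] exI[of _ \<psi>] exI[of _ S] exI[of _ f] exI conjI)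
qed

text \<open>
  The determinant of the derivative of a \<open>C\<^sup>1\<close> lift is continuous.
\<close>

lemma open_regular: "open {x. regular x}"
proof (subst open_subopen, intro ballI)
  fix x assume "x \<in> {x. regular x}"
  then have x: "regular x" by simp
  obtain U \<phi> where U: "(U, \<phi>) \<in> A" "x \<in> U" "is_chart (U, \<phi>)"
    using chart_at by blast
  note ch = is_chartD[OF U(3)]
  obtain S f where S: "\<phi> x \<in> S" "S \<subseteq> \<phi> ` U" "local_lift (F \<circ> the_inv_into U \<phi>) S f" "Ck_on k S f"
    using lift_at[OF U(1,2)] .
  have "open S" using S(3) by (simp add: local_lift_def)
  let ?J = "\<lambda>z. matrix (frechet_derivative f (at z))"
  have inj_iff: "inj (frechet_derivative f (at z)) \<longleftrightarrow> det (?J z) \<noteq> 0" if "z \<in> S" for z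
    using det_nz_iff_inj[OF has_derivative_linear[OF lift_has_derivative[OF S(4) that]]] by simp
  have "cont_diff_on 0 S (\<lambda>z. ?J z $ i $ j)" for i j
  proof -
    have "cont_diff_on 0 S (\<lambda>z. frechet_derivative f (at z) (axis j 1))"
      using C1[OF S(4)] by simp
    from cont_diff_on_bounded_linear[OF bounded_linear_vec_nth \<open>open S\<close> this]
    show ?thesis by (simp add: matrix_def)
  qed
  from cont_diff_on_det[OF \<open>open S\<close> this]
  have "continuous_on S (\<lambda>z. det (?J z))" by simp
  then have "open ((\<lambda>z. det (?J z)) -` (- {0}) \<inter> S)" (is "open ?T")
    using \<open>open S\<close> by (simp add: continuous_on_open_vimage open_Compl)
  moreover have "\<phi> x \<in> ?T"
    using regular_derivative[OF x U(1,2) S(1,3) lift_has_derivative[OF S(4,1)]] inj_iff S(1) by simp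
  moreover have "regular y" if "y \<in> U" "\<phi> y \<in> ?T" for y
    unfolding regular_def
    using that U(1) S(3) inj_iff lift_has_derivative[OF S(4), of "\<phi> y"]
    by (intro exI[of _ U] exI[of _ \<phi>] exI[of _ S] exI[of _ f] exI[of _ "frechet_derivative f (at (\<phi> y))"]) simp
  ultimately show "\<exists>T. open T \<and> x \<in> T \<and> T \<subseteq> {x. regular x}"
    using ch(9)[of ?T] U(2) by (intro exI[of _ "U \<inter> \<phi> -` ?T"]) auto
qed

text \<open>
  By compactness finitely many charts suffice, and modulo integer vectors every critical value
  is a critical value of one of the finitely many local lifts.
\<close>

lemma negligible_singular_values: "negligible (mod1 -` F ` {x. \<not> regular x})"
proof -
  have "\<exists>U \<phi> S f. (U, \<phi>) \<in> A \<and> x \<in> U \<and> \<phi> x \<in> S \<and> local_lift (F \<circ> the_inv_into U \<phi>) S f \<and> Ck_on k S f" for x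
  proof -
    obtain U \<phi> where U: "(U, \<phi>) \<in> A" "x \<in> U" "is_chart (U, \<phi>)"
      using chart_at by blast
    obtain S f where "\<phi> x \<in> S" "S \<subseteq> \<phi> ` U" "local_lift (F \<circ> the_inv_into U \<phi>) S f" "Ck_on k S f"
      using lift_at[OF U(1,2)] .
    then show ?thesis
      using U(1,2) by (intro exI[of _ U] exI[of _ \<phi>] exI[of _ S] exI[of _ f] conjI)
  qed
  then obtain U \<phi> S f where c: "\<And>x. (U x, \<phi> x) \<in> A" "\<And>x. x \<in> U x" "\<And>x. \<phi> x x \<in> S x"
    "\<And>x. local_lift (F \<circ> the_inv_into (U x) (\<phi> x)) (S x) (f x)" "\<And>x. Ck_on k (S x) (f x)"
    by metis
  note ch = is_chartD[OF chart[OF c(1)]]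
  have "open (U x \<inter> \<phi> x -` S x)" if "x \<in> UNIV" for x
    using c(4)[of x] ch(9) by (simp add: local_lift_def)
  moreover have "UNIV \<subseteq> (\<Union>x\<in>UNIV. U x \<inter> \<phi> x -` S x)"
    using c(2,3) by blast
  ultimately obtain D where D: "finite D" "UNIV \<subseteq> (\<Union>x\<in>D. U x \<inter> \<phi> x -` S x)"
    by (rule compactE_image[OF compact])
  define K where "K x = f x ` {z \<in> S x. \<not> inj (frechet_derivative (f x) (at z))}" for x
  have K: "negligible (K x)" for x
    unfolding K_def
    by (rule negligible_critical_values[where f' = "\<lambda>z. frechet_derivative (f x) (at z)"])
      (use lift_has_derivative[OF c(5)] in auto)
  let ?Z = "{l :: real^'n. \<forall>i. l $ i \<in> \<int>}"
  have "negligible (\<Union>l\<in>?Z. (+) l ` (\<Union>x\<in>D. K x))"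
    using D(1) K countable_integer_vectors
    by (intro negligible_countable_Union) (auto intro!: negligible_translation)
  moreover have "mod1 -` F ` {x. \<not> regular x} \<subseteq> (\<Union>l\<in>?Z. (+) l ` (\<Union>x\<in>D. K x))"
  proof
    fix y assume "y \<in> mod1 -` F ` {x. \<not> regular x}"
    then obtain p where p: "mod1 y = F p" "\<not> regular p" by auto
    obtain x where x: "x \<in> D" "p \<in> U x" "\<phi> x p \<in> S x"
      using D(2) by blast
    let ?z = "\<phi> x p"
    have "F p = mod1 (f x ?z)"
      using c(4)[of x] x ch(6)[of p x] by (simp add: local_lift_def)
    then have "y - f x ?z \<in> ?Z"
      using p(1) by (simp add: mod1_eq_iff)
    moreover have "\<not> inj (frechet_derivative (f x) (at ?z))"
      using p(2) c(1)[of x] c(4)[of x] x lift_has_derivative[OF c(5) x(3)]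
      unfolding regular_def by blast
    then have "f x ?z \<in> K x"
      using x(3) by (auto simp: K_def)
    ultimately have "(y - f x ?z) + f x ?z \<in> (\<Union>l\<in>?Z. (+) l ` (\<Union>x\<in>D. K x))"
      using x(1) by blast
    then show "y \<in> (\<Union>l\<in>?Z. (+) l ` (\<Union>x\<in>D. K x))" by simp
  qed
  ultimately show ?thesis
    using negligible_subset by blast
qed

text \<open>
  The critical values would form a closed set containing a dense orbit, hence everything, whereas they
  are negligible.
\<close>

lemma all_regular: "regular x"
proof (rule ccontr)
  assume x: "\<not> regular x"
  let ?R = "mod1 -` F ` {x. \<not> regular x}"
  have "closed {x. \<not> regular x}"
    using open_regular by (simp add: closed_def Compl_eq)
  then have "compact {x. \<not> regular x}"
    using compact compact_Int_closed[OF compact] by (metis inf_top_left)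
  then have "compact (F ` {x. \<not> regular x})"
    using F continuous_on_subset by (intro compact_continuous_image) (auto simp: Ck_map_def)
  then have "closed ?R"
    by (intro closed_vimage compact_imp_closed continuous_on_mod1)
  obtain y where y: "F x = mod1 y"
    by (metis surj_mod1)
  \<comment> \<open>Flowing backwards carries regular points to regular points, so the orbit of \<open>x\<close> stays critical.\<close>
  have orbit: "t *\<^sub>R \<omega> - z + y \<in> ?R" if "\<And>i. z $ i \<in> \<int>" for t z
  proof -
    have "\<not> regular (\<Phi> t x)"
      using regular_flow[of "\<Phi> t x" "- t"] x by (auto simp: flow_zero simp flip: flow_add)
    moreover have "mod1 (t *\<^sub>R \<omega> - z + y) = F (\<Phi> t x)"
      using that by (simp add: F_flow y mod1_eq_iff flip: mod1_add)
    ultimately show ?thesis by auto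
  qed
  have "\<alpha> \<in> closure ?R" for \<alpha>
    unfolding closure_approachable
  proof (intro allI impI)
    fix e :: real assume "e > 0"
    obtain t z where z: "\<And>i. z $ i \<in> \<int>" "norm (t *\<^sub>R \<omega> - z - (\<alpha> - y)) < e"
      using rationally_independent_flow_dense[OF independent \<open>e > 0\<close>] by blast
    then show "\<exists>y\<in>?R. dist y \<alpha> < e"
      using orbit[OF z(1), of t] by (intro bexI[of _ "t *\<^sub>R \<omega> - z + y"]) (simp_all add: dist_norm algebra_simps)
  qed
  then have "?R = UNIV"
    using \<open>closed ?R\<close> by auto
  then show False
    using negligible_singular_values non_negligible_UNIV by metis
qed

text \<open>
  The topological part is the inverse function theorem; regularity on all of \<open>S\<close>, rather than
  at \<open>\<phi> p\<close> alone, then makes the inverse as smooth as \<open>F\<close>.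
\<close>

lemma local_inverse:
  assumes U: "(U, \<phi>) \<in> A" "p \<in> U"
  obtains S f W h where "\<phi> p \<in> S" "S \<subseteq> \<phi> ` U" "local_lift (F \<circ> the_inv_into U \<phi>) S f" "Ck_on k S f"
    "\<forall>z\<in>S. inj (frechet_derivative f (at z))"
    "open W" "homeomorphism S W f h" "Ck_on k W h"
proof -
  note ch = is_chartD[OF chart[OF U(1)]]
  obtain S f where S: "\<phi> p \<in> S" "S \<subseteq> \<phi> ` U" "local_lift (F \<circ> the_inv_into U \<phi>) S f" "Ck_on k S f"
    using lift_at[OF U] .
  note der = lift_has_derivative[OF S(4)]
  have "open S" using S(3) by (simp add: local_lift_def)
  define f' where "f' z = Blinfun (frechet_derivative f (at z))" for z
  have f': "blinfun_apply (f' z) = frechet_derivative f (at z)" if "z \<in> S" for z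
    unfolding f'_def by (rule bounded_linear_Blinfun_apply) (use der[OF that] in \<open>simp add: has_derivative_bounded_linear\<close>)
  have inj: "inj (frechet_derivative f (at z))" if "z \<in> S" for z
  proof -
    obtain x where "x \<in> U" "z = \<phi> x"
      using \<open>z \<in> S\<close> S(2) by blast
    then show ?thesis
      using regular_derivative[OF all_regular U(1) _ _ S(3) der] that by blast
  qed
  have "linear (frechet_derivative f (at (\<phi> p)))"
    using has_derivative_linear[OF der[OF S(1)]] .
  then obtain g where g: "linear g" "g \<circ> frechet_derivative f (at (\<phi> p)) = id"
    using linear_injective_left_inverse inj[OF S(1)] by blast
  have "Blinfun g o\<^sub>L f' (\<phi> p) = id_blinfun"
  proof (rule blinfun_eqI)
    have "blinfun_apply (Blinfun g) = g"
      using g(1) by (simp add: bounded_linear_Blinfun_apply linear_conv_bounded_linear)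
    then show "blinfun_apply (Blinfun g o\<^sub>L f' (\<phi> p)) v = blinfun_apply id_blinfun v" for v
      using fun_cong[OF g(2), of v] S(1) by (simp add: f')
  qed
  moreover have "continuous_on S f'"
  proof (rule continuous_on_blinfun_componentwise)
    fix i :: "real^'n" assume "i \<in> Basis"
    have "continuous_on S (\<lambda>z. frechet_derivative f (at z) i)"
      using C1[OF S(4)] by simp
    then show "continuous_on S (\<lambda>z. blinfun_apply (f' z) i)"
      by (rule continuous_on_eq) (simp add: f')
  qed
  moreover have "(f has_derivative blinfun_apply (f' z)) (at z)" if "z \<in> S" for z
    using der[OF that] by (simp add: f'[OF that])
  ultimately obtain S' W h where S': "open S'" "S' \<subseteq> S" "\<phi> p \<in> S'" "open W" "homeomorphism S' W f h"
    using inverse_function_theorem[OF \<open>open S\<close> _ _ S(1), of f f' "Blinfun g" thesis] by auto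
  have "Ck_on k W h"
    unfolding Ck_on_def
  proof (intro allI impI)
    fix m assume m: "enat m \<le> k"
    show "cont_diff_on m W h"
    proof (cases m)
      case 0
      then show ?thesis
        using S'(5) by (simp add: homeomorphism_def)
    next
      case (Suc m')
      have "cont_diff_on (Suc m') S' f"
        using m Ck_on_subset[OF S(4) S'(2)] unfolding Suc Ck_on_def by blast
      then show ?thesis
        unfolding Suc
      proof (rule cont_diff_on_inverse_function[OF S'(1,4), rotated 3])
        show "h ` W \<subseteq> S'" "continuous_on W h" "\<And>y. y \<in> W \<Longrightarrow> f (h y) = y"
          using S'(5) by (auto simp: homeomorphism_def)
        show "det (matrix (frechet_derivative f (at z))) \<noteq> 0" if "z \<in> S'" for z
          using det_nz_iff_inj[OF has_derivative_linear[OF der]] inj that S'(2) by blast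
      qed
    qed
  qed
  moreover have "local_lift (F \<circ> the_inv_into U \<phi>) S' f"
    using S(3) S'(1,2) continuous_on_subset unfolding local_lift_def by blast
  moreover have "inj (frechet_derivative f (at z))" if "z \<in> S'" for z
    using inj S'(2) that by blast
  ultimately show ?thesis
    using S'(2,3,4,5) S(2) Ck_on_subset[OF S(4) S'(2)] by (intro that[of S' f W h]) auto
qed

text \<open>
  The section is made explicit as \<open>w \<mapsto> \<phi>\<inverse> (h (f (\<phi> p) + w))\<close>, since the smoothness of the final
  diffeomorphism is read off from this formula.
\<close>

lemma local_section_in_chart:
  assumes U: "(U, \<phi>) \<in> A" "p \<in> U" and S: "\<phi> p \<in> S" "S \<subseteq> \<phi> ` U"
    and f: "local_lift (F \<circ> the_inv_into U \<phi>) S f" "open W" "homeomorphism S W f h"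
  obtains r where "r > 0" "ball (f (\<phi> p)) r \<subseteq> W"
    "local_section F p r (\<lambda>w. the_inv_into U \<phi> (h (f (\<phi> p) + w)))"
proof -
  note ch = is_chartD[OF chart[OF U(1)]]
  note hom = f(3)[unfolded homeomorphism_def]
  have hS: "h y \<in> S" "f (h y) = y" if "y \<in> W" for y
    using hom that by auto
  have "open S" using f(1) by (simp add: local_lift_def)
  have "f (\<phi> p) \<in> W" using hom S(1) by auto
  then obtain r where r: "r > 0" "ball (f (\<phi> p)) r \<subseteq> W"
    using f(2) openE by blast
  have W: "f (\<phi> p) + w \<in> W" if "w \<in> ball 0 r" for w
    using r(2) that by (auto simp: dist_norm)
  let ?\<sigma> = "\<lambda>w. the_inv_into U \<phi> (h (f (\<phi> p) + w))"
  have "continuous_on (ball 0 r) (\<lambda>w. h (f (\<phi> p) + w))"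
  proof (rule continuous_on_compose2[of W h])
    show "(+) (f (\<phi> p)) ` ball 0 r \<subseteq> W"
      using W by blast
  qed (use hom in \<open>auto intro!: continuous_intros\<close>)
  then have "continuous_on (ball 0 r) ?\<sigma>"
    by (rule continuous_on_compose2[OF ch(5)]) (use hS W S(2) in blast)
  moreover have "?\<sigma> 0 = p"
    using hom S(1) ch(6)[OF U(2)] by simp
  moreover have "F (?\<sigma> w) = mod1 w + F p" if "w \<in> ball 0 r" for w
  proof -
    have "F (?\<sigma> w) = mod1 (f (h (f (\<phi> p) + w)))"
      using f(1) hS(1)[OF W[OF that]] by (simp add: local_lift_def)
    also have "\<dots> = mod1 w + mod1 (f (\<phi> p))"
      using hS(2)[OF W[OF that]] by (simp add: mod1_add torus_add_commute)
    also have "mod1 (f (\<phi> p)) = F p"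
      using f(1) S(1) ch(6)[OF U(2)] by (simp add: local_lift_def)
    finally show ?thesis .
  qed
  moreover have "open (?\<sigma> ` B)" if B: "open B" "B \<subseteq> ball 0 r" for B
  proof -
    let ?B = "(+) (f (\<phi> p)) ` B"
    have BW: "?B \<subseteq> W" using W B(2) by blast
    have "open ?B" using B(1) by (rule open_translation)
    have "h ` ?B = f -` ?B \<inter> S" (is "h ` ?C = _")
    proof (intro equalityI subsetI)
      fix z assume "z \<in> h ` ?C"
      then obtain y where "y \<in> ?C" "z = h y" by (rule imageE)
      then show "z \<in> f -` ?C \<inter> S"
        using subsetD[OF BW, of y] hS[of y] by simp
    next
      fix z assume "z \<in> f -` ?C \<inter> S"
      then show "z \<in> h ` ?C"
        using hom by (intro image_eqI[of z _ "f z"]) simp_all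
    qed
    then have "open (h ` ?B)"
      using f(1) \<open>open ?B\<close> \<open>open S\<close> by (simp add: local_lift_def continuous_on_open_vimage)
    have hB: "h ` ?B \<subseteq> \<phi> ` U" using hS(1) BW S(2) by blast
    have "the_inv_into U \<phi> ` h ` ?B = U \<inter> \<phi> -` (h ` ?B)" (is "_ ` ?C = _")
    proof (intro equalityI subsetI)
      fix x assume "x \<in> the_inv_into U \<phi> ` ?C"
      then obtain z where "z \<in> ?C" "x = the_inv_into U \<phi> z" by (rule imageE)
      then show "x \<in> U \<inter> \<phi> -` ?C"
        using subsetD[OF hB, of z] ch(7,8)[of z] by simp
    next
      fix x assume "x \<in> U \<inter> \<phi> -` ?C"
      then show "x \<in> the_inv_into U \<phi> ` ?C"
        using ch(6)[of x] by (intro image_eqI[of x _ "\<phi> x"]) simp_all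
    qed
    then have "open (the_inv_into U \<phi> ` h ` ?B)"
      using ch(9)[OF \<open>open (h ` ?B)\<close>] by simp
    then show ?thesis by (simp add: image_image)
  qed
  ultimately have "local_section F p r ?\<sigma>"
    using r(1) by (simp add: local_section_def)
  then show ?thesis
    by (rule that[OF r])
qed

lemma local_section_exists: "\<exists>r \<sigma>. local_section F p r \<sigma>"
proof -
  obtain U \<phi> where U: "(U, \<phi>) \<in> A" "p \<in> U" "is_chart (U, \<phi>)"
    using chart_at by blast
  obtain S f W h where "\<phi> p \<in> S" "S \<subseteq> \<phi> ` U" "local_lift (F \<circ> the_inv_into U \<phi>) S f"
    "open W" "homeomorphism S W f h"
    by (rule local_inverse[OF U(1,2)])
  then obtain r where "local_section F p r (\<lambda>w. the_inv_into U \<phi> (h (f (\<phi> p) + w)))"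
    by (rule local_section_in_chart[OF U(1,2)])
  then show ?thesis by blast
qed

lemma local_section_inj_on:
  assumes "local_section F p r \<sigma>"
  shows "inj_on F (\<sigma> ` ball 0 (min r (1/2)))"
proof (rule inj_onI, clarsimp)
  fix u v :: "real^'n"
  assume uv: "norm u < r" "norm v < r" "norm u * 2 < 1" "norm v * 2 < 1" "F (\<sigma> u) = F (\<sigma> v)"
  then have "F p + mod1 u = F p + mod1 v"
    using assms by (simp add: local_section_def torus_add_commute)
  then have "mod1 u = mod1 v"
    by (simp add: torus_add_left_cancel)
  then show "\<sigma> u = \<sigma> v"
    using inj_on_mod1_ball[of 0] uv by (auto dest!: inj_onD)
qed

lemma locally_injective: "\<exists>N. open N \<and> p \<in> N \<and> inj_on F N"
proof -
  obtain r \<sigma> where s: "local_section F p r \<sigma>"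
    using local_section_exists by blast
  then have "open (\<sigma> ` ball 0 (min r (1/2)))"
    unfolding local_section_def by (metis open_ball subset_ball min.cobounded1)
  moreover have "p \<in> \<sigma> ` ball 0 (min r (1/2))"
    using s unfolding local_section_def by (intro image_eqI[of _ _ 0]) auto
  ultimately show ?thesis
    using local_section_inj_on[OF s] by blast
qed

end

section \<open>Immersions into the torus and rotations\<close>

text \<open>
  The block matrix \<open>((0, -\<Theta>), (\<Theta>, 0))\<close> with \<open>\<Theta> = diag \<theta>\<close>: coordinates \<open>i\<close> and \<open>i + n\<close> form the
  \<open>i\<close>-th plane of rotation.
\<close>

definition rotation_generator :: "nat \<Rightarrow> (nat \<Rightarrow> real) \<Rightarrow> nat \<Rightarrow> nat \<Rightarrow> real" where
  "rotation_generator n \<theta> i j =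
     (if i < n \<and> j = i + n then - \<theta> i else if n \<le> i \<and> i < 2 * n \<and> i = j + n then \<theta> j else 0)"

text \<open>
  The block matrix \<open>((c, -s), (s, c))\<close> with diagonal blocks. All powers of the generator and its
  exponential have this shape.
\<close>

definition rotation :: "nat \<Rightarrow> (nat \<Rightarrow> real) \<Rightarrow> (nat \<Rightarrow> real) \<Rightarrow> nat \<Rightarrow> nat \<Rightarrow> real" where
  "rotation n c s i j =
     (if i = j then c (if i < n then i else i - n)
      else if i < n \<and> j = i + n then - s i else if n \<le> i \<and> i < 2 * n \<and> i = j + n then s j else 0)"

lemma sum_rotation:
  assumes "i < 2 * n"
  shows "(\<Sum>j<2 * n. rotation n c s i j * y j) =
    (if i < n then c i * y i - s i * y (i + n) else c (i - n) * y i + s (i - n) * y (i - n))"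
proof (cases "i < n")
  case True
  have "(\<Sum>j<2 * n. rotation n c s i j * y j) = (\<Sum>j\<in>{i, i + n}. rotation n c s i j * y j)"
    using True by (intro sum.mono_neutral_right) (auto simp: rotation_def)
  then show ?thesis
    using True by (simp add: rotation_def)
next
  case False
  have "(\<Sum>j<2 * n. rotation n c s i j * y j) = (\<Sum>j\<in>{i, i - n}. rotation n c s i j * y j)"
    using False assms by (intro sum.mono_neutral_right) (auto simp: rotation_def)
  then show ?thesis
    using False assms by (auto simp: rotation_def)
qed

lemma rotation_generator_eq: "rotation_generator n \<theta> = rotation n (\<lambda>_. 0) \<theta>" if "n > 0"
  using that by (intro ext) (auto simp: rotation_generator_def rotation_def)

text \<open>
  The \<open>p\<close>-th power is \<open>p!\<close> times the \<open>p\<close>-th Taylor terms of cosine and sine, so that summation of the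
  exponential series gives the rotation matrix.
\<close>

lemma mat_power_rotation_generator:
  assumes "i < 2 * n" "j < 2 * n"
  shows "mat_power (2 * n) (rotation_generator n \<theta>) p i j =
    fact p * rotation n (\<lambda>a. cos_coeff p * \<theta> a ^ p) (\<lambda>a. sin_coeff p * \<theta> a ^ p) i j"
  using assms
proof (induction p arbitrary: i j)
  case 0
  then show ?case by (simp add: rotation_def)
next
  case (Suc p)
  have n: "n > 0" using Suc.prems by simp
  have "mat_power (2 * n) (rotation_generator n \<theta>) (Suc p) i j =
      (\<Sum>l<2 * n. rotation n (\<lambda>_. 0) \<theta> i l *
        (fact p * rotation n (\<lambda>a. cos_coeff p * \<theta> a ^ p) (\<lambda>a. sin_coeff p * \<theta> a ^ p) l j))"
    using Suc n by (simp add: rotation_generator_eq)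
  also have "\<dots> = fact (Suc p) * rotation n (\<lambda>a. cos_coeff (Suc p) * \<theta> a ^ Suc p)
      (\<lambda>a. sin_coeff (Suc p) * \<theta> a ^ Suc p) i j"
    using Suc.prems
    by (subst sum_rotation)
      (auto simp: rotation_def cos_coeff_Suc sin_coeff_Suc field_simps simp del: of_nat_Suc)
  finally show ?case .
qed

lemma mat_exp_rotation_generator:
  assumes "i < 2 * n" "j < 2 * n"
  shows "mat_exp (2 * n) (rotation_generator n \<theta>) i j =
    rotation n (\<lambda>a. cos (\<theta> a)) (\<lambda>a. sin (\<theta> a)) i j"
proof -
  have sin: "summable (\<lambda>p. sin_coeff p * x ^ p)" for x :: real
    using summable_norm_cancel[OF summable_norm_sin[of x]] by simp
  have "mat_exp (2 * n) (rotation_generator n \<theta>) i j =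
      (\<Sum>p. rotation n (\<lambda>a. cos_coeff p * \<theta> a ^ p) (\<lambda>a. sin_coeff p * \<theta> a ^ p) i j)"
    using assms by (simp add: mat_exp_def mat_power_rotation_generator)
  also have "\<dots> = rotation n (\<lambda>a. cos (\<theta> a)) (\<lambda>a. sin (\<theta> a)) i j"
    by (auto simp: rotation_def cos_def sin_def suminf_minus[OF sin])
  finally show ?thesis .
qed

text \<open>
  Smoothness and injectivity of the derivative are recorded for one and the same lift, since both
  are needed for the functions \<open>cos (2 \<pi> G\<^sub>i)\<close> and \<open>sin (2 \<pi> G\<^sub>i)\<close>.
\<close>

definition Ck_immersion_into_torus :: "enat \<Rightarrow> ('a::topological_space, 'e::euclidean_space) chart set \<Rightarrow>
    ('a \<Rightarrow> 'n::finite torus) \<Rightarrow> bool" where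
  "Ck_immersion_into_torus k A G \<longleftrightarrow> (\<forall>(U, \<phi>)\<in>A. \<forall>p\<in>U. \<exists>S f.
     \<phi> p \<in> S \<and> S \<subseteq> \<phi> ` U \<and> local_lift (G \<circ> the_inv_into U \<phi>) S f \<and> Ck_on k S f \<and>
     inj (frechet_derivative f (at (\<phi> p))))"

lemma Ck_immersion_into_torusE:
  assumes "Ck_immersion_into_torus k A G" "(U, \<phi>) \<in> A" "p \<in> U"
  obtains S f where "\<phi> p \<in> S" "S \<subseteq> \<phi> ` U" "local_lift (G \<circ> the_inv_into U \<phi>) S f" "Ck_on k S f"
     "inj (frechet_derivative f (at (\<phi> p)))"
proof -
  have "\<exists>S f. \<phi> p \<in> S \<and> S \<subseteq> \<phi> ` U \<and> local_lift (G \<circ> the_inv_into U \<phi>) S f \<and> Ck_on k S f \<and>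
     inj (frechet_derivative f (at (\<phi> p)))"
    using assms unfolding Ck_immersion_into_torus_def by fast
  then show ?thesis
    by (elim exE conjE) (rule that)
qed

lemma Ck_immersion_into_torus_imp_Ck_map:
  fixes A :: "('a::t2_space, 'e::euclidean_space) chart set"
  assumes "Ck_atlas k A" "Ck_immersion_into_torus k A G"
  shows "Ck_map k A torus_atlas G"
proof (rule Ck_map_torusI[OF assms(1)])
  fix U \<phi> p assume "(U, \<phi>) \<in> A" "p \<in> U"
  then obtain S f where "\<phi> p \<in> S" "S \<subseteq> \<phi> ` U" "local_lift (G \<circ> the_inv_into U \<phi>) S f" "Ck_on k S f"
    by (rule Ck_immersion_into_torusE[OF assms(2)])
  then show "\<exists>S f. \<phi> p \<in> S \<and> S \<subseteq> \<phi> ` U \<and> local_lift (G \<circ> the_inv_into U \<phi>) S f \<and> Ck_on k S f"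
    by (intro exI[of _ S] exI[of _ f] conjI)
qed

lemma Ck_map_smooth_torus_function:
  fixes A :: "('a::t2_space, 'e::euclidean_space) chart set" and c :: "'n::finite torus \<Rightarrow> real"
  assumes A: "Ck_atlas k A" and G: "Ck_immersion_into_torus k A G"
    and c: "\<And>y. c (mod1 y) = u y" "\<And>m. cont_diff_on m UNIV u"
  shows "Ck_map k A std_atlas (\<lambda>x. c (G x))"
proof -
  have chart: "is_chart (U, \<phi>)" if "(U, \<phi>) \<in> A" for U \<phi>
    using A that by (auto simp: Ck_atlas_def)
  have "isCont (\<lambda>x. c (G x)) p" for p
  proof -
    obtain U \<phi> where U: "(U, \<phi>) \<in> A" "p \<in> U"
      using Ck_atlas_chart_at[OF A] by blast
    obtain S f where S: "\<phi> p \<in> S" "local_lift (G \<circ> the_inv_into U \<phi>) S f"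
      using Ck_immersion_into_torusE[OF G U] by metis
    show ?thesis
    proof (rule isCont_via_chart[OF chart[OF U(1)] U(2) _ S(1)])
      show "open S" using S(2) by (simp add: local_lift_def)
      show "continuous_on S (\<lambda>z. u (f z))"
        by (rule continuous_on_compose2[of UNIV u])
          (use cont_diff_on_imp_continuous_on[OF c(2)] S(2) in \<open>auto simp: local_lift_def\<close>)
      show "c (G x) = u (f (\<phi> x))" if "x \<in> U" "\<phi> x \<in> S" for x
        using S(2) is_chartD(6)[OF chart[OF U(1)] that(1)] that(2) by (simp add: local_lift_def flip: c(1))
    qed
  qed
  moreover have "Ck_on k (\<phi> ` U) (\<lambda>z. c (G (the_inv_into U \<phi> z)))" if U: "(U, \<phi>) \<in> A" for U \<phi>
  proof (rule Ck_on_local)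
    fix z assume "z \<in> \<phi> ` U"
    then obtain p where p: "z = \<phi> p" "p \<in> U" by blast
    obtain S f where S: "z \<in> S" "local_lift (G \<circ> the_inv_into U \<phi>) S f" "Ck_on k S f"
      unfolding p(1) by (rule Ck_immersion_into_torusE[OF G U p(2)])
    have "open S" using S(2) by (simp add: local_lift_def)
    have "Ck_on k S (\<lambda>w. u (f w))"
      using S(3) cont_diff_on_compose[OF \<open>open S\<close> subset_UNIV c(2)] unfolding Ck_on_def by blast
    moreover have "\<forall>w\<in>S. c (G (the_inv_into U \<phi> w)) = u (f w)"
      using S(2) by (simp add: local_lift_def flip: c(1))
    ultimately show "\<exists>T f'. open T \<and> z \<in> T \<and> Ck_on k T f' \<and> (\<forall>w\<in>T. c (G (the_inv_into U \<phi> w)) = f' w)"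
      using \<open>open S\<close> S(1) by (intro exI[of _ S] exI[of _ "\<lambda>w. u (f w)"] conjI)
  qed
  ultimately show ?thesis
    by (auto simp: Ck_map_def std_atlas_def continuous_at_imp_continuous_on comp_def)
qed

definition torus_cos :: "'n::finite \<Rightarrow> 'n torus \<Rightarrow> real" where
  "torus_cos i a = cos (2 * pi * torus_rep a $ i)"

definition torus_sin :: "'n::finite \<Rightarrow> 'n torus \<Rightarrow> real" where
  "torus_sin i a = sin (2 * pi * torus_rep a $ i)"

text \<open>
  These functions are defined through an arbitrary representative; periodicity makes the choice
  irrelevant.
\<close>

lemma torus_cos_mod1: "torus_cos i (mod1 y) = cos (2 * pi * y $ i)"
  and torus_sin_mod1: "torus_sin i (mod1 y) = sin (2 * pi * y $ i)"
proof -
  have "mod1 (torus_rep (mod1 y)) = mod1 y"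
    by (rule Quotient_abs_rep[OF Quotient_torus])
  then have "torus_rep (mod1 y) $ i - y $ i \<in> \<int>"
    by (simp add: mod1_eq_iff)
  then obtain l where "torus_rep (mod1 y) $ i = y $ i + of_int l"
    by (metis Ints_cases add.commute diff_add_cancel)
  then have "2 * pi * torus_rep (mod1 y) $ i = 2 * pi * y $ i + 2 * pi * of_int l"
    by (simp add: algebra_simps)
  then have "sin (2 * pi * torus_rep (mod1 y) $ i) = sin (2 * pi * y $ i) \<and>
      cos (2 * pi * torus_rep (mod1 y) $ i) = cos (2 * pi * y $ i)"
    unfolding sin_cos_eq_iff by (intro exI[of _ l]) simp
  then show "torus_cos i (mod1 y) = cos (2 * pi * y $ i)" "torus_sin i (mod1 y) = sin (2 * pi * y $ i)"
    by (simp_all add: torus_cos_def torus_sin_def)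
qed

lemma torus_eqI_cos_sin:
  assumes "\<And>i. torus_cos i a = torus_cos i b" "\<And>i. torus_sin i a = torus_sin i b"
  shows "a = b"
proof -
  obtain x y where xy: "a = mod1 x" "b = mod1 y" by (metis surj_mod1)
  have "x $ i - y $ i \<in> \<int>" for i
  proof -
    have "sin (2 * pi * x $ i) = sin (2 * pi * y $ i) \<and> cos (2 * pi * x $ i) = cos (2 * pi * y $ i)"
      using assms[of i] by (simp add: xy torus_cos_mod1 torus_sin_mod1)
    then obtain l where "2 * pi * x $ i = 2 * pi * y $ i + 2 * pi * of_int l"
      unfolding sin_cos_eq_iff by blast
    then have "2 * pi * (x $ i - y $ i) = 2 * pi * of_int l"
      by (simp add: algebra_simps)
    then have "x $ i - y $ i = of_int l" by simp
    then show ?thesis by simp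
  qed
  then show ?thesis by (simp add: xy mod1_eq_iff)
qed

lemma cont_diff_on_cos_sin_component:
  fixes i :: "'n::finite"
  shows "cont_diff_on m UNIV (\<lambda>y :: real^'n. cos (2 * pi * y $ i))"
    "cont_diff_on m UNIV (\<lambda>y :: real^'n. sin (2 * pi * y $ i))"
proof -
  have "cont_diff_on m UNIV (\<lambda>y :: real^'n. 2 * pi * y $ i)"
    by (rule cont_diff_on_bounded_linear[OF _ open_UNIV cont_diff_on_id])
      (intro bounded_linear_const_mult bounded_linear_vec_nth)
  then show "cont_diff_on m UNIV (\<lambda>y :: real^'n. cos (2 * pi * y $ i))"
    "cont_diff_on m UNIV (\<lambda>y :: real^'n. sin (2 * pi * y $ i))"
    by (rule cont_diff_on_compose[OF open_UNIV subset_UNIV cont_diff_on_sin_cos(2)]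
        cont_diff_on_compose[OF open_UNIV subset_UNIV cont_diff_on_sin_cos(1)])+
qed

text \<open>
  Sine and cosine have no common zero.
\<close>

lemma cos_sin_derivatives_vanish:
  fixes f :: "'e::euclidean_space \<Rightarrow> real"
  assumes f: "(f has_derivative D) (at z)"
    and "frechet_derivative (\<lambda>z. cos (f z)) (at z) v = 0" "frechet_derivative (\<lambda>z. sin (f z)) (at z) v = 0"
  shows "D v = 0"
proof -
  have "((\<lambda>z. cos (f z)) has_derivative (\<lambda>v. - (D v * sin (f z)))) (at z)"
    "((\<lambda>z. sin (f z)) has_derivative (\<lambda>v. D v * cos (f z))) (at z)"
    using f by (auto intro!: derivative_eq_intros)
  from this[THEN frechet_derivative_at] assms(2,3)
  have "D v * sin (f z) = 0" "D v * cos (f z) = 0"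
    by (metis neg_equal_0_iff_equal, metis)
  then show ?thesis
    using sin_zero_abs_cos_one[of "f z"] by auto
qed

text \<open>
  The map with components \<open>cos (2 \<pi> G\<^sub>i)\<close> and \<open>sin (2 \<pi> G\<^sub>i)\<close> is an injective immersion of a compact
  space, hence an embedding, and a translation of the torus acts on these components by
  rotations.
\<close>

lemma torus_immersion_linearizable:
  fixes A :: "('a::{t2_space, second_countable_topology}, 'e::euclidean_space) chart set"
    and G :: "'a \<Rightarrow> 'n::finite torus"
  assumes k: "1 \<le> k" and A: "Ck_atlas k A" and cpt: "compact (UNIV :: 'a set)"
    and G: "Ck_immersion_into_torus k A G" "inj G"
    and flow: "\<And>t x. G (\<Phi> t x) = mod1 (t *\<^sub>R \<omega>) + G x"
  shows "linearizable_by_Ck_embedding k A \<Phi>"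
proof -
  let ?n = "CARD('n)"
  obtain e where e: "bij_betw e {..<?n} (UNIV :: 'n set)"
    using ex_bij_betw_nat_finite[of "UNIV :: 'n set"] by (auto simp: atLeast0LessThan)
  define E where "E x j = (if j < ?n then torus_cos (e j) (G x)
      else if j < 2 * ?n then torus_sin (e (j - ?n)) (G x) else 0)" for x j
  have Ecos: "E x j = torus_cos (e j) (G x)" if "j < ?n" for x j
    using that by (simp add: E_def)
  have Esin: "E x (j + ?n) = torus_sin (e j) (G x)" if "j < ?n" for x j
    using that by (simp add: E_def)
  have surj_e: "\<exists>j<?n. e j = i" for i
    using e by (metis UNIV_I bij_betw_def imageE lessThan_iff)
  have Ck: "Ck_map k A std_atlas (\<lambda>x. E x j)" if j: "j < 2 * ?n" for j
  proof (cases "j < ?n")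
    case True
    then show ?thesis
      using Ck_map_smooth_torus_function[OF A G(1) torus_cos_mod1 cont_diff_on_cos_sin_component(1)]
      by (simp add: E_def)
  next
    case False
    then show ?thesis
      using Ck_map_smooth_torus_function[OF A G(1) torus_sin_mod1 cont_diff_on_cos_sin_component(2)] j
      by (simp add: E_def)
  qed
  have imm: "v = 0" if U: "(U, \<phi>) \<in> A" "p \<in> U"
    and zero: "\<And>j. j < 2 * ?n \<Longrightarrow> frechet_derivative (\<lambda>z. E (the_inv_into U \<phi> z) j) (at (\<phi> p)) v = 0"
    for U \<phi> p v
  proof -
    obtain S f where S: "\<phi> p \<in> S" "local_lift (G \<circ> the_inv_into U \<phi>) S f" "Ck_on k S f"
      and inj: "inj (frechet_derivative f (at (\<phi> p)))"
      by (rule Ck_immersion_into_torusE[OF G(1) U])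
    have oS: "open S" using S(2) by (simp add: local_lift_def)
    have "cont_diff_on (Suc 0) S f"
      using S(3) k unfolding Ck_on_def one_enat_def One_nat_def by blast
    then have D: "(f has_derivative frechet_derivative f (at (\<phi> p))) (at (\<phi> p))"
      using S(1) by (rule cont_diff_on_has_derivative)
    have local: "frechet_derivative g (at (\<phi> p)) = frechet_derivative h (at (\<phi> p))"
      if "\<And>z. z \<in> S \<Longrightarrow> g z = h z" for g h :: "'e \<Rightarrow> real"
    proof -
      have "(g has_derivative D) (at (\<phi> p)) \<longleftrightarrow> (h has_derivative D) (at (\<phi> p))" for D
        using has_derivative_transform_within_open[OF _ oS S(1)] that by metis
      then show ?thesis by (simp add: frechet_derivative_def)
    qed
    have "frechet_derivative f (at (\<phi> p)) v $ i = 0" for i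
    proof -
      obtain j where j: "j < ?n" "e j = i" using surj_e by blast
      have comp: "((\<lambda>z. 2 * pi * f z $ i) has_derivative
          (\<lambda>v. 2 * pi * frechet_derivative f (at (\<phi> p)) v $ i)) (at (\<phi> p))"
        by (intro has_derivative_mult_right bounded_linear.has_derivative[OF bounded_linear_vec_nth] D)
      have "2 * pi * frechet_derivative f (at (\<phi> p)) v $ i = 0"
      proof (rule cos_sin_derivatives_vanish[OF comp])
        have "frechet_derivative (\<lambda>z. cos (2 * pi * f z $ i)) (at (\<phi> p)) =
            frechet_derivative (\<lambda>z. E (the_inv_into U \<phi> z) j) (at (\<phi> p))"
          by (rule local) (use S(2) j in \<open>simp add: Ecos local_lift_def flip: torus_cos_mod1\<close>)
        then show "frechet_derivative (\<lambda>z. cos (2 * pi * f z $ i)) (at (\<phi> p)) v = 0"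
          using zero[of j] j(1) by simp
        have "frechet_derivative (\<lambda>z. sin (2 * pi * f z $ i)) (at (\<phi> p)) =
            frechet_derivative (\<lambda>z. E (the_inv_into U \<phi> z) (j + ?n)) (at (\<phi> p))"
          by (rule local) (use S(2) j in \<open>simp add: Esin local_lift_def flip: torus_sin_mod1\<close>)
        then show "frechet_derivative (\<lambda>z. sin (2 * pi * f z $ i)) (at (\<phi> p)) v = 0"
          using zero[of "j + ?n"] j(1) by simp
      qed
      then show ?thesis by simp
    qed
    then have "frechet_derivative f (at (\<phi> p)) v = frechet_derivative f (at (\<phi> p)) 0"
      using linear_0[OF has_derivative_linear[OF D]] by (simp add: vec_eq_iff)
    then show ?thesis using inj by (simp add: inj_eq)
  qed
  have top: "E x \<in> topspace (Euclidean_space (2 * ?n))" for x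
    by (simp add: topspace_Euclidean_space E_def)
  have "inj E"
  proof (rule injI)
    fix x y assume eq: "E x = E y"
    have "torus_cos i (G x) = torus_cos i (G y)" "torus_sin i (G x) = torus_sin i (G y)" for i
    proof -
      obtain j where "j < ?n" "e j = i" using surj_e by blast
      then show "torus_cos i (G x) = torus_cos i (G y)" "torus_sin i (G x) = torus_sin i (G y)"
        using fun_cong[OF eq, of j] fun_cong[OF eq, of "j + ?n"] by (simp_all add: Ecos Esin)
    qed
    then have "G x = G y" by (rule torus_eqI_cos_sin)
    then show "x = y" using G(2) by (simp add: inj_eq)
  qed
  have cont: "continuous_on UNIV (\<lambda>x. E x j)" for j
  proof (cases "j < 2 * ?n")
    case True
    then show ?thesis using Ck by (simp add: Ck_map_def)
  qed (simp add: E_def)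
  have "embedding_map euclidean (Euclidean_space (2 * ?n)) E"
  proof (rule continuous_imp_embedding_map)
    show "continuous_map euclidean (Euclidean_space (2 * ?n)) E"
      using top cont unfolding Euclidean_space_def
      by (auto simp: continuous_map_in_subtopology continuous_map_componentwise_UNIV)
    show "compact_space (euclidean :: 'a topology)"
      using cpt by (simp add: compact_space_def)
    show "Hausdorff_space (Euclidean_space (2 * ?n))"
      by (simp add: Hausdorff_Euclidean_space)
    show "inj_on E (topspace euclidean)"
      using \<open>inj E\<close> by simp
  qed
  then have "Ck_embedding k A (2 * ?n) E"
    unfolding Ck_embedding_def using top Ck imm by blast
  moreover have "linearizing \<Phi> (2 * ?n) E"
    unfolding linearizing_def
  proof (intro exI allI impI)
    fix t x i assume i: "i < 2 * ?n"
    let ?\<theta> = "\<lambda>a. 2 * pi * (t * \<omega> $ e a)"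
    let ?B = "rotation_generator ?n (\<lambda>a. 2 * pi * \<omega> $ e a)"
    have B: "(\<lambda>a b. ?B a b * t) = rotation_generator ?n ?\<theta>"
      by (auto simp: rotation_generator_def fun_eq_iff)
    obtain y where y: "G x = mod1 y" by (metis surj_mod1)
    have Gt: "G (\<Phi> t x) = mod1 (t *\<^sub>R \<omega> + y)"
      by (simp add: flow y mod1_add)
    have "(\<Sum>j<2 * ?n. mat_exp (2 * ?n) (\<lambda>a b. ?B a b * t) i j * E x j)
        = (\<Sum>j<2 * ?n. rotation ?n (\<lambda>a. cos (?\<theta> a)) (\<lambda>a. sin (?\<theta> a)) i j * E x j)"
      unfolding B using i by (simp add: mat_exp_rotation_generator)
    also have "\<dots> = E (\<Phi> t x) i"
    proof (cases "i < ?n")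
      case True
      then show ?thesis
        unfolding sum_rotation[OF i]
        by (simp add: Ecos Esin Gt y torus_cos_mod1 torus_sin_mod1 cos_add distrib_left)
    next
      case False
      then obtain j where "i = j + ?n" "j < ?n"
        using i by (metis add.commute add_less_cancel_left le_Suc_ex mult_2 not_less)
      then show ?thesis
        unfolding sum_rotation[OF i]
        by (simp add: Ecos Esin Gt y torus_cos_mod1 torus_sin_mod1 sin_add distrib_left)
    qed
    finally show "E (\<Phi> t x) i = (\<Sum>j<2 * ?n. mat_exp (2 * ?n) (\<lambda>a b. ?B a b * t) i j * E x j)" ..
  qed
  ultimately show ?thesis
    unfolding linearizable_by_Ck_embedding_def by blast
qed

section \<open>The phase space is a torus\<close>

context flow_over_torus
begin

text \<open>
  Both sides lift the same map on the ball and agree at its centre. This identifies the abstract action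
  with the explicit local sections.
\<close>

lemma translations_extend_sections:
  assumes P: "lifted_translations F P" and s: "local_section F p r \<sigma>" and w: "norm w < r"
  shows "P w p = \<sigma> w"
proof (rule unique_lift[OF locally_injective, where S = "ball 0 r" and a = "\<lambda>w. P w p" and b = \<sigma>])
  note P' = P[unfolded lifted_translations_def] and s' = s[unfolded local_section_def]
  show "continuous_on (ball 0 r) (\<lambda>w. P w p)"
    by (rule continuous_on_subset[OF _ subset_UNIV]) (use P' in simp)
  show "continuous_on (ball 0 r) \<sigma>" "P 0 p = \<sigma> 0" "0 \<in> ball 0 r"
    using P' s' by simp_all
  show "F (P s p) = F (\<sigma> s)" if "s \<in> ball 0 r" for s
    using P' s' that by simp
qed (use w in simp_all)

text \<open>
  Both curves start at \<open>x\<close> and project to the same orbit of the linear flow.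
\<close>

lemma flow_eq_translation:
  assumes P: "lifted_translations F P"
  shows "\<Phi> t x = P (t *\<^sub>R \<omega>) x"
proof (rule unique_lift[OF locally_injective, where S = UNIV and a = "\<lambda>t. \<Phi> t x" and b = "\<lambda>t. P (t *\<^sub>R \<omega>) x"])
  note P' = P[unfolded lifted_translations_def]
  show "continuous_on UNIV (\<lambda>t. P (t *\<^sub>R \<omega>) x)"
    by (rule continuous_on_compose2[of UNIV "\<lambda>v. P v x"]) (use P' in \<open>auto intro!: continuous_intros\<close>)
  show "\<Phi> 0 x = P (0 *\<^sub>R \<omega>) x" "F (\<Phi> s x) = F (P (s *\<^sub>R \<omega>) x)" for s
    using P' by (simp_all add: flow_zero F_flow)
qed (use continuous_on_flow_time in simp_all)

text \<open>
  The map induced by \<open>y \<mapsto> P (M y) x\<^sub>0\<close> on the torus; the choice of representative does not matter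
  once \<open>M \<int>\<^sup>n\<close> is the stabilizer of \<open>x\<^sub>0\<close>. Its inverse is the diffeomorphism \<open>\<psi>\<close>.
\<close>

definition lattice_chart :: "(real^'n \<Rightarrow> 'a \<Rightarrow> 'a) \<Rightarrow> real^'n^'n \<Rightarrow> 'a \<Rightarrow> 'n torus \<Rightarrow> 'a" where
  "lattice_chart P M x\<^sub>0 a = P (M *v torus_rep a) x\<^sub>0"

context
  fixes P :: "real^'n \<Rightarrow> 'a \<Rightarrow> 'a" and M :: "real^'n^'n" and x\<^sub>0 :: 'a
  assumes P: "lifted_translations F P" and M: "invertible M"
    and stab: "P (M *v y) x\<^sub>0 = x\<^sub>0 \<longleftrightarrow> (\<forall>i. y $ i \<in> \<int>)"
begin

abbreviation g where "g \<equiv> lattice_chart P M x\<^sub>0"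

lemma P_add: "P u (P v x) = P (u + v) x" and P_zero: "P 0 x = x"
  using P by (simp_all add: lifted_translations_def)

lemma translates_eq_iff: "P (M *v y) x\<^sub>0 = P (M *v z) x\<^sub>0 \<longleftrightarrow> mod1 y = mod1 z"
proof -
  have "P (M *v y) x\<^sub>0 = P (M *v z) x\<^sub>0 \<longleftrightarrow> P (- (M *v z)) (P (M *v y) x\<^sub>0) = P (- (M *v z)) (P (M *v z) x\<^sub>0)"
    by (metis P_add P_zero add.right_inverse)
  also have "\<dots> \<longleftrightarrow> P (M *v (y - z)) x\<^sub>0 = x\<^sub>0"
    by (simp add: P_add P_zero matrix_vector_mult_diff_distrib)
  also have "\<dots> \<longleftrightarrow> mod1 y = mod1 z"
    by (simp add: stab mod1_eq_iff)
  finally show ?thesis .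
qed

lemma lattice_chart_mod1: "g (mod1 y) = P (M *v y) x\<^sub>0"
  unfolding lattice_chart_def translates_eq_iff by (rule Quotient_abs_rep[OF Quotient_torus])

lemma M_inverse: "M *v (matrix_inv M *v y) = y" "matrix_inv M *v (M *v y) = y"
proof -
  have "M ** matrix_inv M = mat 1 \<and> matrix_inv M ** M = mat 1"
    unfolding matrix_inv_def using M[unfolded invertible_def] by (rule someI_ex)
  then show "M *v (matrix_inv M *v y) = y" "matrix_inv M *v (M *v y) = y"
    by (simp_all add: matrix_vector_mul_assoc)
qed

lemma lattice_chart_inverse: "g (mod1 (matrix_inv M *v v)) = P v x\<^sub>0"
  by (simp add: lattice_chart_mod1 M_inverse)

lemma bij_lattice_chart: "bij g"
proof (rule bijI)
  show "inj g"
  proof (rule injI)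
    fix a b assume "g a = g b"
    moreover obtain y z where "a = mod1 y" "b = mod1 z" by (metis surj_mod1)
    ultimately show "a = b" by (simp add: lattice_chart_mod1 translates_eq_iff)
  qed
  have "\<exists>a. x = g a" for x
  proof -
    obtain v where "P v x\<^sub>0 = x" using lifted_translations_transitive[OF P connected] .
    then have "x = g (mod1 (matrix_inv M *v v))" by (simp add: lattice_chart_inverse)
    then show ?thesis ..
  qed
  then show "surj g" by (simp add: surj_def)
qed

lemma inv_lattice_chart_translate: "inv g (P v x\<^sub>0) = mod1 (matrix_inv M *v v)"
  using bij_lattice_chart lattice_chart_inverse by (metis bij_inv_eq_iff)

text \<open>
  Near \<open>p = P v x\<^sub>0\<close> a point with coordinate \<open>z\<close> is \<open>P (f z - f (\<phi> p) + v) x\<^sub>0\<close>, where \<open>f\<close> is a lift of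
  \<open>F\<close>. So \<open>M\<inverse> (f z - f (\<phi> p) + v)\<close> lifts the inverse chart, and it inherits smoothness and
  invertibility of the derivative from \<open>f\<close>.
\<close>

lemma immersion_inv_lattice_chart: "Ck_immersion_into_torus k A (inv g)"
  unfolding Ck_immersion_into_torus_def
proof (intro ballI, clarify)
  fix U \<phi> p assume U: "(U, \<phi>) \<in> A" "p \<in> U"
  obtain S f W h where S: "\<phi> p \<in> S" "S \<subseteq> \<phi> ` U"
    and f: "local_lift (F \<circ> the_inv_into U \<phi>) S f" "Ck_on k S f"
    and inj: "\<forall>z\<in>S. inj (frechet_derivative f (at z))"
    and h: "open W" "homeomorphism S W f h" "Ck_on k W h"
    using local_inverse[OF U] .
  obtain r where r: "r > 0" "ball (f (\<phi> p)) r \<subseteq> W"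
    and sec: "local_section F p r (\<lambda>w. the_inv_into U \<phi> (h (f (\<phi> p) + w)))"
    by (rule local_section_in_chart[OF U S f(1) h(1,2)])
  obtain v where v: "P v x\<^sub>0 = p"
    using lifted_translations_transitive[OF P connected] .
  define N where "N = matrix_inv M"
  define T where "T = f -` ball (f (\<phi> p)) r \<inter> S"
  define f' where "f' z = N *v f z + (N *v v - N *v f (\<phi> p))" for z
  have "open S" "continuous_on S f"
    using f(1) by (simp_all add: local_lift_def)
  then have "open T"
    unfolding T_def by (simp add: continuous_on_open_vimage)
  have T: "\<phi> p \<in> T" "T \<subseteq> S"
    using S(1) r(1) by (auto simp: T_def)
  have lin: "bounded_linear ((*v) N)"
    by (rule matrix_vector_mul_bounded_linear)
  have Ck: "Ck_on k T f'"
    unfolding Ck_on_def f'_def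
  proof (intro allI impI cont_diff_on_add[OF \<open>open T\<close>] cont_diff_on_const cont_diff_on_bounded_linear[OF lin \<open>open T\<close>])
    show "cont_diff_on m T f" if "enat m \<le> k" for m
      using Ck_on_subset[OF f(2) T(2)] that by (simp add: Ck_on_def)
  qed
  have "mod1 (f' z) = inv g (the_inv_into U \<phi> z)" if z: "z \<in> T" for z
  proof -
    have "norm (f z - f (\<phi> p)) < r"
      using z by (simp add: T_def dist_norm norm_minus_commute)
    from translations_extend_sections[OF P sec this]
    have "P (f z - f (\<phi> p)) p = the_inv_into U \<phi> z"
      using h(2) z by (simp add: T_def homeomorphism_def)
    then have "the_inv_into U \<phi> z = P (f z - f (\<phi> p) + v) x\<^sub>0"
      by (simp add: P_add flip: v)
    then show ?thesis
      by (simp add: inv_lattice_chart_translate f'_def N_def matrix_vector_mult_diff_distrib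
          matrix_vector_right_distrib algebra_simps)
  qed
  then have lift: "local_lift (inv g \<circ> the_inv_into U \<phi>) T f'"
    using \<open>open T\<close> Ck_on_imp_continuous_on[OF Ck] by (simp add: local_lift_def)
  have D: "(f has_derivative frechet_derivative f (at (\<phi> p))) (at (\<phi> p))"
    by (rule lift_has_derivative[OF f(2) S(1)])
  have "(f' has_derivative (\<lambda>u. N *v frechet_derivative f (at (\<phi> p)) u + 0)) (at (\<phi> p))"
    unfolding f'_def by (intro has_derivative_add bounded_linear.has_derivative[OF lin] D has_derivative_const)
  then have "frechet_derivative f' (at (\<phi> p)) = (\<lambda>u. N *v frechet_derivative f (at (\<phi> p)) u)"
    by (simp flip: frechet_derivative_at)
  moreover have "inj (\<lambda>u. N *v frechet_derivative f (at (\<phi> p)) u)"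
  proof (rule injI)
    fix a b assume "N *v frechet_derivative f (at (\<phi> p)) a = N *v frechet_derivative f (at (\<phi> p)) b"
    then have "frechet_derivative f (at (\<phi> p)) a = frechet_derivative f (at (\<phi> p)) b"
      unfolding N_def using M_inverse(1) by metis
    then show "a = b" using bspec[OF inj S(1)] by (simp add: inj_eq)
  qed
  ultimately have "inj (frechet_derivative f' (at (\<phi> p)))" by simp
  then show "\<exists>S f. \<phi> p \<in> S \<and> S \<subseteq> \<phi> ` U \<and> local_lift (inv g \<circ> the_inv_into U \<phi>) S f \<and> Ck_on k S f \<and>
     inj (frechet_derivative f (at (\<phi> p)))"
    using T S(2) lift Ck by (intro exI[of _ T] exI[of _ f'] conjI) (assumption | rule subset_trans)+
qed

text \<open>
  Near \<open>y\<close>, with \<open>p\<close> the image of \<open>y\<close>, the chart expression is \<open>w \<mapsto> h (f (\<phi> p) + M (w - y))\<close> with the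
  \<open>C\<^sup>k\<close> local inverse \<open>h\<close> of a lift \<open>f\<close> of \<open>F\<close>.
\<close>

lemma Ck_map_lattice_chart: "Ck_map k torus_atlas A g"
  unfolding Ck_map_def
proof (intro conjI ballI, safe)
  have "continuous_on UNIV (\<lambda>y. P (M *v y) x\<^sub>0)"
    by (rule continuous_on_compose2[of UNIV "\<lambda>v. P v x\<^sub>0"])
      (use P in \<open>auto simp: lifted_translations_def intro!: linear_continuous_on matrix_vector_mul_bounded_linear\<close>)
  then have "open (mod1 -` g -` B)" if "open B" for B
    using that by (simp add: vimage_def lattice_chart_mod1 continuous_on_open_vimage[OF open_UNIV])
  then show "continuous_on UNIV g"
    by (simp add: continuous_on_open_vimage open_torus_def)
  fix Q s U \<phi> assume "(Q, s) \<in> (torus_atlas :: ('n torus, real^'n) chart set)" and U: "(U, \<phi>) \<in> A"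
  then obtain V where V: "Q = mod1 ` V" "s = the_inv_into V mod1" "open V" "inj_on mod1 V"
    by (auto simp: torus_atlas_def)
  note ch = is_chartD[OF chart[OF U]]
  show "Ck_on k (s ` (Q \<inter> g -` U)) (\<phi> \<circ> g \<circ> the_inv_into Q s)"
  proof (rule Ck_on_local)
    fix y assume "y \<in> s ` (Q \<inter> g -` U)"
    then have y: "y \<in> V" "g (mod1 y) \<in> U"
      using the_inv_into_f_f[OF V(4)] by (auto simp: V)
    define p where "p = g (mod1 y)"
    have "p \<in> U" using y(2) by (simp add: p_def)
    obtain S f W h where S: "\<phi> p \<in> S" "S \<subseteq> \<phi> ` U"
      and f: "local_lift (F \<circ> the_inv_into U \<phi>) S f"
      and h: "open W" "homeomorphism S W f h" "Ck_on k W h"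
      using local_inverse[OF U \<open>p \<in> U\<close>] .
    obtain r where r: "r > 0" "ball (f (\<phi> p)) r \<subseteq> W"
      and sec: "local_section F p r (\<lambda>w. the_inv_into U \<phi> (h (f (\<phi> p) + w)))"
      by (rule local_section_in_chart[OF U \<open>p \<in> U\<close> S f h(1,2)])
    define a where "a w = M *v w + (f (\<phi> p) - M *v y)" for w
    have a: "cont_diff_on m UNIV a" for m
      unfolding a_def
      by (intro cont_diff_on_add open_UNIV cont_diff_on_const
          cont_diff_on_bounded_linear[OF matrix_vector_mul_bounded_linear open_UNIV cont_diff_on_id])
    define T where "T = a -` ball (f (\<phi> p)) r \<inter> V"
    have "open T"
      using V(3) cont_diff_on_imp_continuous_on[OF a]
      unfolding T_def by (intro open_Int open_vimage open_ball)
    moreover have "y \<in> T" using y(1) r(1) by (simp add: T_def a_def)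
    moreover have aT: "a ` T \<subseteq> W" using r(2) by (auto simp: T_def)
    have "Ck_on k T (\<lambda>w. h (a w))"
      using h(3) cont_diff_on_compose[OF \<open>open T\<close> aT _ cont_diff_on_subset[OF a subset_UNIV]]
      unfolding Ck_on_def by blast
    moreover have "(\<phi> \<circ> g \<circ> the_inv_into Q s) w = h (a w)" if w: "w \<in> T" for w
    proof -
      have "w \<in> V" using w by (simp add: T_def)
      have "f (\<phi> p) + (M *v w - M *v y) = a w"
        by (simp add: a_def)
      moreover have "norm (M *v w - M *v y) < r"
        using w by (simp add: T_def a_def dist_norm norm_minus_commute algebra_simps)
      ultimately have "P (M *v w - M *v y) p = the_inv_into U \<phi> (h (a w))"
        using translations_extend_sections[OF P sec, of "M *v w - M *v y"] by simp
      then have "g (mod1 w) = the_inv_into U \<phi> (h (a w))"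
        by (simp add: p_def lattice_chart_mod1 P_add)
      moreover have "a w \<in> W" using aT w by blast
      then have "h (a w) \<in> \<phi> ` U"
        using h(2) S(2) by (auto simp: homeomorphism_def)
      ultimately show ?thesis
        using torus_chart(2)[OF V(3,4) \<open>w \<in> V\<close>] ch(7) by (simp add: V)
    qed
    ultimately show "\<exists>T f'. open T \<and> y \<in> T \<and> Ck_on k T f' \<and> (\<forall>w\<in>T. (\<phi> \<circ> g \<circ> the_inv_into Q s) w = f' w)"
      by (intro exI[of _ T] exI[of _ "\<lambda>w. h (a w)"] conjI ballI)
  qed
qed

lemma inv_lattice_chart_flow: "inv g (\<Phi> t x) = mod1 (t *\<^sub>R (matrix_inv M *v \<omega>)) + inv g x"
proof -
  obtain v where v: "P v x\<^sub>0 = x"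
    using lifted_translations_transitive[OF P connected] .
  have "\<Phi> t x = P (t *\<^sub>R \<omega> + v) x\<^sub>0"
    by (simp add: flow_eq_translation[OF P] P_add flip: v)
  then show ?thesis
    by (simp add: inv_lattice_chart_translate matrix_vector_right_distrib matrix_vector_mult_scaleR
        mod1_add flip: v)
qed

end

text \<open>
  The base point is chosen over \<open>0\<close>, so that the matrix describes \<open>F\<close> without an additive constant.
  Its stabilizer is contained in \<open>\<int>\<^sup>n\<close> because \<open>F\<close> maps \<open>P l x\<^sub>0\<close> to \<open>l\<close> modulo \<open>1\<close>.
\<close>

lemma integral_lattice_chart:
  obtains P and M :: "int^'n^'n" and x\<^sub>0 where "lifted_translations F P" "invertible (map_matrix real_of_int M)" "F x\<^sub>0 = mod1 0"
    "\<forall>y. P (map_matrix real_of_int M *v y) x\<^sub>0 = x\<^sub>0 \<longleftrightarrow> (\<forall>i. y $ i \<in> \<int>)"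
proof -
  obtain P where P: "lifted_translations F P"
    using lifted_translations_exist[OF compact local_section_exists locally_injective] .
  note P' = P[unfolded lifted_translations_def]
  obtain y where y: "F undefined = mod1 y" by (metis surj_mod1)
  define x\<^sub>0 where "x\<^sub>0 = P (- y) undefined"
  have x0: "F x\<^sub>0 = mod1 0"
    using P' by (simp add: x\<^sub>0_def y flip: mod1_add)
  have "finite {x. F x = F x\<^sub>0}"
    by (rule finite_fibre[OF compact _ locally_injective]) (use F in \<open>simp add: Ck_map_def\<close>)
  then obtain d where d: "d > 0" "\<And>i. P (real d *\<^sub>R axis i 1) x\<^sub>0 = x\<^sub>0"
    using stabilizer_full_rank[OF P] by blast
  let ?L = "{v. P v x\<^sub>0 = x\<^sub>0}"
  have basis: "real d *\<^sub>R axis i 1 \<in> ?L" for i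
    using d(2) by simp
  have int: "l $ i \<in> \<int>" if "l \<in> ?L" for l i
  proof -
    have "F (P l x\<^sub>0) = mod1 l + F x\<^sub>0" using P' by blast
    then have "mod1 l = mod1 0"
      using that by (simp add: x0 flip: mod1_add)
    then show ?thesis by (simp add: mod1_eq_iff)
  qed
  have zero: "0 \<in> ?L" using P' by simp
  have add: "l + m \<in> ?L" if "l \<in> ?L" "m \<in> ?L" for l m
  proof -
    have "P (l + m) x\<^sub>0 = P l (P m x\<^sub>0)" using P' by simp
    then show ?thesis using that by simp
  qed
  have minus: "- l \<in> ?L" if "l \<in> ?L" for l
  proof -
    have "P (- l) (P l x\<^sub>0) = x\<^sub>0" using P' by simp
    then show ?thesis using that by simp
  qed
  obtain M :: "int^'n^'n" where "invertible (map_matrix real_of_int M)"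
    "\<forall>y. map_matrix real_of_int M *v y \<in> ?L \<longleftrightarrow> (\<forall>i. y $ i \<in> \<int>)"
    using full_rank_sublattice_basis[OF d(1) basis int zero add minus] .
  then show ?thesis
    using that[OF P _ x0] by simp
qed

end

theorem proposition2:
  fixes k :: enat
    and A :: "('a::{t2_space, second_countable_topology}, real^'n) chart set"
    and \<Phi> :: "real \<Rightarrow> 'a \<Rightarrow> 'a"
    and F :: "'a \<Rightarrow> 'n torus"
    and \<omega> :: "real^'n"
  assumes "1 \<le> k"
    and "Ck_manifold k A"
    and "compact (UNIV :: 'a set)"
    and "connected (UNIV :: 'a set)"
    and "Ck_flow k A \<Phi>"
    and "Ck_map k A torus_atlas F"
    and "rationally_independent \<omega>"
    and "\<forall>x t. F (\<Phi> t x) = mod1 (t *\<^sub>R \<omega>) + F x"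
  shows "(\<exists>\<psi> :: 'a \<Rightarrow> 'n torus.
            Ck_diffeomorphism k A torus_atlas \<psi> \<and>
            (\<exists>M :: int^'n^'n. invertible (map_matrix real_of_int M) \<and>
               (\<forall>y. F (inv \<psi> (mod1 y)) = mod1 (map_matrix real_of_int M *v y))) \<and>
            (\<exists>\<omega>' :: real^'n. rationally_independent \<omega>' \<and>
               (\<forall>t y. \<psi> (\<Phi> t (inv \<psi> y)) = mod1 (t *\<^sub>R \<omega>') + y)))
         \<and> linearizable_by_Ck_embedding k A \<Phi>"
proof -
  interpret flow_over_torus k A \<Phi> F \<omega>
    by unfold_locales (use assms in auto)
  obtain P and M :: "int^'n^'n" and x\<^sub>0 where P: "lifted_translations F P" and M: "invertible (map_matrix real_of_int M)"
    and x0: "F x\<^sub>0 = mod1 0"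
    and stab_all: "\<forall>y. P (map_matrix real_of_int M *v y) x\<^sub>0 = x\<^sub>0 \<longleftrightarrow> (\<forall>i. y $ i \<in> \<int>)"
    using integral_lattice_chart .
  let ?M = "map_matrix real_of_int M"
  let ?g = "lattice_chart P ?M x\<^sub>0"
  have stab: "P (?M *v y) x\<^sub>0 = x\<^sub>0 \<longleftrightarrow> (\<forall>i. y $ i \<in> \<int>)" for y
    using stab_all by blast
  let ?\<omega>' = "matrix_inv ?M *v \<omega>"
  note bij = bij_lattice_chart[OF P M stab]
  note imm = immersion_inv_lattice_chart[OF P M stab]
  note flow = inv_lattice_chart_flow[OF P M stab]
  have inv: "inv (inv ?g) = ?g"
    by (rule inv_inv_eq[OF bij])
  have "Ck_diffeomorphism k A torus_atlas (inv ?g)"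
    unfolding Ck_diffeomorphism_def inv
    using bij_imp_bij_inv[OF bij] Ck_immersion_into_torus_imp_Ck_map[OF atlas imm]
      Ck_map_lattice_chart[OF P M stab] by blast
  moreover have "F (inv (inv ?g) (mod1 y)) = mod1 (?M *v y)" for y
    using P by (simp add: inv lattice_chart_mod1[OF P M stab] lifted_translations_def x0 flip: mod1_add)
  moreover have "rationally_independent ?\<omega>'"
    by (rule rationally_independent_matrix_preimage[OF _ M])
      (use assms(7) in \<open>simp add: M_inverse[OF P M stab]\<close>)
  moreover have "inv ?g (\<Phi> t (inv (inv ?g) y)) = mod1 (t *\<^sub>R ?\<omega>') + y" for t y
    using bij by (simp add: inv flow bij_is_inj)
  moreover have "linearizable_by_Ck_embedding k A \<Phi>"
    by (rule torus_immersion_linearizable[OF assms(1) atlas assms(3) imm _ flow])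
      (rule bij_is_inj[OF bij_imp_bij_inv[OF bij]])
  ultimately show ?thesis
    using M by blast
qed

end
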